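(* For every graph $G$ and every integer $r\ge 1$, $$\lambda(G)^r \le \sum_{v\in V(G)} w_r(v)\,\frac{c_G(v)-1}{c_G(v)}.$$ Moreover, equality holds if and only if either $G$ is edgeless, or, after deleting all isolated vertices of $G$, the remaining graph is as follows: it is a regular complete $\omega(G)$-partite graph when $r=1$ or $\omega(G)\ge 3$, and it is a complete bipartite graph when $r\ge 2$ and $\omega(G)=2$, where in the latter case, if $r$ is odd, the remaining complete bipartite graph is additionally required to be regular.
   Context: All graphs are finite and simple. For a graph $G$, $\lambda(G)$ denotes the largest eigenvalue of its adjacency matrix $A(G)$, and $\omega(G)$ denotes its clique number. For a vertex $v\in V(G)$, $c_G(v)$ is the maximum order (number of vertices) of a clique in $G$ containing $v$ (so $c_G(v)=1$ if $v$ is isolated). For a vertex $v$ and an integer $r\ge 1$, $w_r(v)$ is the number of walks on $r$ vertices (vertices may repeat; consecutive vertices adjacent) starting at $v$; equivalently $w_r(v)=(A(G)^{r-1}\mathbf{1})_v$, where $\mathbf 1$ is the all-one vector (so $w_1(v)=1$). *)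

theory Defs
  imports
    "Graph_Theory.Graph_Theory"
    "Jordan_Normal_Form.Spectral_Radius"
    "HOL-Library.Disjoint_Sets"
begin

(* Finite simple graphs are the locale graph of Graph_Theory: finite, loopfree, symmetric
   digraphs without parallel arcs, an edge uv being the pair of arcs (u,v) and (v,u).  That
   locale admits the null graph. *)

(* Jordan_Normal_Form matrices are indexed by {0..<n}, so the vertices have to be listed.
   Another listing conjugates the matrix by a permutation, which leaves its spectrum unchanged. *)
definition vertex_list :: "('a, 'b) pre_digraph \<Rightarrow> 'a list" where
  "vertex_list G = (SOME vs. distinct vs \<and> set vs = verts G)"

definition adjacency_matrix :: "('a, 'b) pre_digraph \<Rightarrow> real mat" where
  "adjacency_matrix G =
     mat (card (verts G)) (card (verts G))
       (\<lambda>(i, j). if (vertex_list G ! i) \<rightarrow>\<^bsub>G\<^esub> (vertex_list G ! j) then 1 else 0)"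

(* Meaningful for non-null graphs only: the 0 x 0 matrix has empty spectrum. *)
definition largest_eigenvalue :: "('a, 'b) pre_digraph \<Rightarrow> real" where
  "largest_eigenvalue G = Max (spectrum (adjacency_matrix G))"

definition is_clique :: "('a, 'b) pre_digraph \<Rightarrow> 'a set \<Rightarrow> bool" where
  "is_clique G C \<longleftrightarrow> C \<subseteq> verts G \<and> K\<^bsub>card C\<^esub> (G \<restriction> C)"

definition clique_number :: "('a, 'b) pre_digraph \<Rightarrow> nat" where
  "clique_number G = Max {card C | C. is_clique G C}"

definition local_clique_number :: "('a, 'b) pre_digraph \<Rightarrow> 'a \<Rightarrow> nat" where
  "local_clique_number G v = Max {card C | C. is_clique G C \<and> v \<in> C}"

(* The parameter r counts vertices, not edges. *)
definition num_walks :: "('a, 'b) pre_digraph \<Rightarrow> nat \<Rightarrow> 'a \<Rightarrow> nat" where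
  "num_walks G r v = card {p. vwalk p G \<and> length p = r \<and> hd p = v}"

definition edgeless :: "('a, 'b) pre_digraph \<Rightarrow> bool" where
  "edgeless G \<longleftrightarrow> arcs G = {}"

definition isolated :: "('a, 'b) pre_digraph \<Rightarrow> 'a \<Rightarrow> bool" where
  "isolated G v \<longleftrightarrow> v \<in> verts G \<and> (\<forall>u. \<not> v \<rightarrow>\<^bsub>G\<^esub> u)"

definition delete_isolated :: "('a, 'b) pre_digraph \<Rightarrow> ('a, 'b) pre_digraph" where
  "delete_isolated G = G \<restriction> (verts G - {v. isolated G v})"

(* In a symmetric digraph without parallel arcs the out-degree is the vertex degree. *)
definition regular :: "('a, 'b) pre_digraph \<Rightarrow> bool" where
  "regular G \<longleftrightarrow> (\<exists>d. \<forall>v\<in>verts G. out_degree G v = d)"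

(* The parts are nonempty, by the definition of partition_on. *)
definition complete_multipartite :: "nat \<Rightarrow> ('a, 'b) pre_digraph \<Rightarrow> bool" where
  "complete_multipartite k G \<longleftrightarrow>
     (\<exists>P. partition_on (verts G) P \<and> card P = k \<and>
       (\<forall>u\<in>verts G. \<forall>v\<in>verts G. u \<rightarrow>\<^bsub>G\<^esub> v \<longleftrightarrow> \<not> (\<exists>X\<in>P. u \<in> X \<and> v \<in> X)))"

definition complete_bipartite :: "('a, 'b) pre_digraph \<Rightarrow> bool" where
  "complete_bipartite G \<longleftrightarrow> (\<exists>m n. m \<ge> 1 \<and> n \<ge> 1 \<and> K\<^bsub>m,n\<^esub> G)"

end

theory Submission
  imports Defs "HOL-Analysis.Function_Topology" "HOL-Analysis.Convex"
begin

text \<open>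
  Let \<open>A\<close> be the adjacency matrix, \<open>\<lambda>\<close> its largest eigenvalue with a nonnegative unit eigenvector
  \<open>x\<close>, let \<open>w(v)\<close> be the number of walks on \<open>r\<close> vertices starting at \<open>v\<close>, and put
  \<open>\<phi>(v) = (c(v) - 1) / c(v)\<close> for the local clique number \<open>c\<close>. With \<open>u(v) = x(v) sqrt (w(v))\<close> the inequality
  is the chain

  \<open>\<lambda>^r \<le> u\<^sup>T A u \<le> (\<Sum>v. u(v) sqrt (\<phi>(v)))^2 \<le> \<Sum>v. w(v) \<phi>(v)\<close>.

  The first step is an entropy bound (\<open>power_le_quad_form_walk_weight\<close>). The Markov chain that moves
  from \<open>i\<close> to a neighbour \<open>j\<close> with probability \<open>x(j) / (\<lambda> x(i))\<close> has stationary distribution \<open>x^2\<close> and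
  entropy rate \<open>ln \<lambda>\<close>; since \<open>r - 1\<close> of its steps are spread over at most \<open>w(i)\<close> walks, the
  average of \<open>ln w\<close> under \<open>x^2\<close> is at least \<open>(r - 1) ln \<lambda>\<close>, and Jensen's inequality over the arcs
  gives one more factor \<open>\<lambda>\<close>. The second step is a localized Motzkin--Straus inequality
  (\<open>local_motzkin_straus\<close>), proved by moving weight between nonadjacent vertices until only a clique
  carries weight; its vertices all have local clique number at least its order. The third step is
  the Cauchy--Schwarz inequality.

  Suppose that equality holds and there is an edge. The last step then forces \<open>x^2\<close> to be proportional to
  \<open>w \<phi>\<close>, so \<open>u\<close> is positive on all nonisolated vertices and is extremal for the middle step. The
  second-order condition there makes nonadjacency transitive (\<open>nonadjacency_trans\<close>): the nonisolated
  vertices form a complete \<open>k\<close>-partite graph, \<open>k\<close> is the clique number, and \<open>\<phi>\<close> is constant on them.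
  The first-order condition (\<open>weighted_walk_sum\<close>) then says that the number of walks on \<open>r + 1\<close> vertices
  is the same from each of them. Conversely, these two properties imply equality
  (\<open>equality_if_multipartite\<close>).

  It remains to see when the walk count is constant. For \<open>r = 1\<close> it is the degree. For \<open>k \<ge> 3\<close> the
  eigenvector equation leaves at most two possible sizes for the parts, and two parts of different
  sizes would exhaust the whole eigenvector, so the graph is regular (\<open>regular_if_three_parts\<close>). For \<open>k = 2\<close> the
  count is constant if \<open>r\<close> is even, and a multiple of the degree if \<open>r\<close> is odd
  (\<open>walks_const_iff_complete_bipartite\<close>).
\<close>

section \<open>Quadratic forms and the Perron vector\<close>

definition quad_form :: "'a set \<Rightarrow> ('a \<Rightarrow> 'a \<Rightarrow> real) \<Rightarrow> ('a \<Rightarrow> real) \<Rightarrow> real" where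
  "quad_form V b z = (\<Sum>i\<in>V. \<Sum>j\<in>V. b i j * z i * z j)"

lemma quad_form_parallelogram:
  "quad_form V b (\<lambda>v. z v + h v) + quad_form V b (\<lambda>v. z v - h v) = 2 * quad_form V b z + 2 * quad_form V b h"
  unfolding quad_form_def sum_distrib_left sum.distrib[symmetric]
  by (intro sum.cong refl) (simp add: algebra_simps)

lemma sum_shift_coordinate:
  fixes z :: "'a \<Rightarrow> real"
  assumes "finite V" "i \<in> V"
  shows "(\<Sum>v\<in>V. c v * (z v + t * of_bool (v = i))) = (\<Sum>v\<in>V. c v * z v) + t * c i"
proof -
  have "(\<Sum>v\<in>V. c v * (z v + t * of_bool (v = i)))
      = (\<Sum>v\<in>V. c v * z v) + (\<Sum>v\<in>V. if v = i then t * c v else 0)"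
    unfolding sum.distrib[symmetric] by (intro sum.cong refl) (simp add: algebra_simps)
  then show ?thesis using assms by (simp add: sum.delta)
qed

text \<open>The expansion of a quadratic form along one coordinate. Every perturbation argument below, first
  or second order, moves finitely many coordinates one at a time with this lemma.\<close>
lemma quad_form_shift_coordinate:
  assumes "finite V" "i \<in> V" and sym: "\<And>i j. b i j = b j i"
  shows "quad_form V b (\<lambda>v. z v + t * of_bool (v = i))
       = quad_form V b z + 2 * t * (\<Sum>j\<in>V. b i j * z j) + t\<^sup>2 * b i i"
proof -
  let ?z = "\<lambda>v. z v + t * of_bool (v = i)"
  have "quad_form V b ?z = (\<Sum>u\<in>V. (\<Sum>v\<in>V. b u v * ?z v) * ?z u)"
    unfolding quad_form_def sum_distrib_right by (intro sum.cong refl) (simp add: mult_ac)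
  also have "\<dots> = (\<Sum>u\<in>V. ((\<Sum>v\<in>V. b u v * z v) + t * b u i) * ?z u)"
    using sum_shift_coordinate[OF assms(1,2)] by simp
  also have "\<dots> = (\<Sum>u\<in>V. ((\<Sum>v\<in>V. b u v * z v) + t * b u i) * z u)
                + t * ((\<Sum>v\<in>V. b i v * z v) + t * b i i)"
    by (rule sum_shift_coordinate[OF assms(1,2)])
  also have "(\<Sum>u\<in>V. ((\<Sum>v\<in>V. b u v * z v) + t * b u i) * z u)
      = quad_form V b z + t * (\<Sum>u\<in>V. b i u * z u)"
    unfolding quad_form_def sum_distrib_left sum_distrib_right sum.distrib[symmetric]
    by (intro sum.cong refl)
       (simp add: algebra_simps sum_distrib_left sum_distrib_right sum.distrib sym[of i])
  finally show ?thesis by (simp add: algebra_simps power2_eq_square)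
qed

text \<open>The squared norm is itself a quadratic form, so perturbing it needs no separate computation.\<close>
lemma quad_form_identity:
  "finite V \<Longrightarrow> quad_form V (\<lambda>i j. of_bool (i = j)) z = (\<Sum>v\<in>V. (z v)\<^sup>2)"
  unfolding quad_form_def
  by (intro sum.cong refl) (simp add: of_bool_def power2_eq_square mult.assoc if_distrib[of "\<lambda>c. c * _"] sum.delta cong: if_cong)

text \<open>The first-order condition at an interior maximum, without derivatives: a linear term of either sign
  that is dominated by a quadratic one vanishes.\<close>
lemma eq_zero_if_linear_le_square:
  fixes g :: real
  assumes "a > 0" and "\<And>t. \<bar>t\<bar> \<le> a \<Longrightarrow> 2 * t * g \<le> t\<^sup>2 * c"
  shows "g = 0"
proof (rule ccontr)
  assume g: "g \<noteq> 0"
  \<comment> \<open>small enough for the quadratic term to lose against \<open>2 * t * \<bar>g\<bar>\<close>\<close>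
  define t where "t = min a (\<bar>g\<bar> / (\<bar>c\<bar> + 1))"
  have t: "0 < t" "t \<le> a" "t \<le> \<bar>g\<bar> / (\<bar>c\<bar> + 1)"
    using assms(1) g by (auto simp: t_def intro!: divide_pos_pos)
  from t(3) have "t * (\<bar>c\<bar> + 1) \<le> \<bar>g\<bar>"
    by (simp add: pos_le_divide_eq)
  have "2 * (sgn g * t) * g \<le> (sgn g * t)\<^sup>2 * c"
    using t by (intro assms(2)) (auto simp: abs_mult sgn_if)
  then have "2 * t * \<bar>g\<bar> \<le> t\<^sup>2 * c"
    using g by (auto simp: sgn_if power2_eq_square split: if_splits)
  then have "2 * \<bar>g\<bar> \<le> t * c"
    using t(1) by (auto simp: power2_eq_square)
  moreover have "t * c \<le> t * (\<bar>c\<bar> + 1)"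
    using t(1) by (intro mult_left_mono) auto
  ultimately show False using \<open>t * (\<bar>c\<bar> + 1) \<le> \<bar>g\<bar>\<close> g by linarith
qed

text \<open>In the product topology on functions this set is a closed subset of a product of compact intervals.
  Pinning the coordinates outside \<open>V\<close> to zero is what makes it compact.\<close>
lemma compact_nonneg_unit_sphere:
  fixes V :: "'a set"
  assumes "finite V"
  shows "compact {x :: 'a \<Rightarrow> real. (\<forall>v\<in>V. 0 \<le> x v) \<and> (\<forall>v. v \<notin> V \<longrightarrow> x v = 0) \<and> (\<Sum>v\<in>V. (x v)\<^sup>2) = 1}"
    (is "compact ?K")
proof -
  let ?B = "PiE UNIV (\<lambda>v. if v \<in> V then {0..1::real} else {0})"
  have "compactin (product_topology (\<lambda>i. euclidean) UNIV) ?B"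
    unfolding compactin_PiE by auto
  then have B: "compact ?B"
    by (simp add: euclidean_product_topology)
  have C: "closed {x :: 'a \<Rightarrow> real. (\<Sum>v\<in>V. (x v)\<^sup>2) = 1}"
    by (intro closed_Collect_eq continuous_intros) auto
  have "?K = ?B \<inter> {x. (\<Sum>v\<in>V. (x v)\<^sup>2) = 1}"
  proof (intro equalityI subsetI)
    fix x assume x: "x \<in> ?K"
    have "x v \<le> 1" if "v \<in> V" for v
    proof -
      have "(x v)\<^sup>2 \<le> (\<Sum>v\<in>V. (x v)\<^sup>2)"
        using that assms by (intro member_le_sum) auto
      then show ?thesis using x by (simp add: power2_le_iff_abs_le abs_square_le_1)
    qed
    then show "x \<in> ?B \<inter> {x. (\<Sum>v\<in>V. (x v)\<^sup>2) = 1}" using x by auto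
  next
    fix x assume x: "x \<in> ?B \<inter> {x. (\<Sum>v\<in>V. (x v)\<^sup>2) = 1}"
    have "x v \<in> (if v \<in> V then {0..1::real} else {0})" for v
      using x by (auto simp: PiE_iff simp del: split_paired_All)
    then have "\<forall>v\<in>V. 0 \<le> x v" "\<forall>v. v \<notin> V \<longrightarrow> x v = 0"
      by (metis atLeastAtMost_iff, metis singletonD)
    then show "x \<in> ?K" using x by auto
  qed
  then show ?thesis using compact_Int_closed[OF B C] by simp
qed

lemma continuous_on_quad_form:
  "continuous_on S (quad_form V b)"
proof -
  have c: "continuous_on S (\<lambda>x :: 'a \<Rightarrow> real. x i)" for i
    using continuous_on_product_coordinates[of i] by (rule continuous_on_subset) (rule subset_UNIV)
  have "continuous_on S (\<lambda>z. b i j * z i * z j)" for i j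
    by (rule continuous_on_mult[OF continuous_on_mult[OF continuous_on_const c] c])
  then show ?thesis
    unfolding quad_form_def[abs_def] by (intro continuous_on_sum) 
qed

text \<open>The part of the Perron--Frobenius theorem that is needed, obtained variationally. The quadratic form
  attains its maximum \<open>\<mu>\<close> over the nonnegative unit vectors. Replacing \<open>y\<close> by its absolute value
  does not decrease the form, because the entries of \<open>a\<close> are nonnegative; so \<open>\<mu>\<close> bounds the Rayleigh
  quotient of every vector, and the first-order condition at the maximizer is the eigenvalue equation.\<close>
lemma perron_vector_exists:
  fixes a :: "'a \<Rightarrow> 'a \<Rightarrow> real"
  assumes fin: "finite V" and ne: "V \<noteq> {}"
    and sym: "\<And>i j. a i j = a j i" and nonneg: "\<And>i j. 0 \<le> a i j"
  obtains \<mu> x where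
    "\<forall>i\<in>V. 0 \<le> x i" "(\<Sum>i\<in>V. (x i)\<^sup>2) = 1"
    "\<forall>i\<in>V. (\<Sum>j\<in>V. a i j * x j) = \<mu> * x i"
    "\<forall>y. quad_form V a y \<le> \<mu> * (\<Sum>i\<in>V. (y i)\<^sup>2)"
proof -
  define K where "K = {x :: 'a \<Rightarrow> real. (\<forall>v\<in>V. 0 \<le> x v) \<and> (\<forall>v. v \<notin> V \<longrightarrow> x v = 0) \<and> (\<Sum>v\<in>V. (x v)\<^sup>2) = 1}"
  obtain v0 where v0: "v0 \<in> V" using ne by auto
  have "(\<lambda>v. of_bool (v = v0)) \<in> K"
    using fin v0 by (auto simp: K_def power2_eq_square of_bool_def if_distrib sum.delta cong: if_cong)
  then have "K \<noteq> {}" by auto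
  moreover have "continuous_on K (quad_form V a)"
    by (rule continuous_on_quad_form)
  ultimately obtain x where x: "x \<in> K" and max: "\<forall>y\<in>K. quad_form V a y \<le> quad_form V a x"
    using continuous_attains_sup[OF compact_nonneg_unit_sphere[OF fin, folded K_def]] by metis
  define \<mu> where "\<mu> = quad_form V a x"
  have le: "quad_form V a y \<le> \<mu> * (\<Sum>i\<in>V. (y i)\<^sup>2)" for y
  proof (cases "(\<Sum>i\<in>V. (y i)\<^sup>2) = 0")
    case True
    then have "\<forall>i\<in>V. y i = 0"
      using fin by (auto simp: sum_nonneg_eq_0_iff)
    then have "quad_form V a y = 0" by (simp add: quad_form_def)
    then show ?thesis using True by simp
  next
    case False
    define s where "s = (\<Sum>i\<in>V. (y i)\<^sup>2)"
    have s: "s > 0" using False by (simp add: s_def sum_nonneg less_le)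
    define z where "z = (\<lambda>v. if v \<in> V then \<bar>y v\<bar> / sqrt s else 0)"
    have "(\<Sum>v\<in>V. (z v)\<^sup>2) = (\<Sum>v\<in>V. (y v)\<^sup>2) / s"
      unfolding sum_divide_distrib using s
      by (intro sum.cong refl) (auto simp: z_def power_divide)
    then have "z \<in> K" using s by (auto simp: K_def z_def s_def[symmetric])
    then have "quad_form V a z \<le> \<mu>" using max by (simp add: \<mu>_def)
    moreover have "quad_form V a y / s \<le> quad_form V a z"
      unfolding quad_form_def sum_divide_distrib
    proof (intro sum_mono)
      fix i j assume ij: "i \<in> V" "j \<in> V"
      have "a i j * y i * y j \<le> a i j * \<bar>y i * y j\<bar>"
        using mult_left_mono[OF abs_ge_self nonneg] by (simp add: mult.assoc)
      then have "a i j * y i * y j / s \<le> a i j * (\<bar>y i\<bar> * \<bar>y j\<bar>) / s"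
        using s by (intro divide_right_mono) (auto simp: abs_mult)
      also have "\<dots> = a i j * z i * z j" using ij s by (simp add: z_def)
      finally show "a i j * y i * y j / s \<le> a i j * z i * z j" .
    qed
    ultimately have "quad_form V a y / s \<le> \<mu>" by linarith
    then show ?thesis using s by (simp add: s_def[symmetric] field_simps)
  qed
  have eig: "(\<Sum>j\<in>V. a i j * x j) = \<mu> * x i" if i: "i \<in> V" for i
  proof -
    have "2 * t * ((\<Sum>j\<in>V. a i j * x j) - \<mu> * x i) \<le> t\<^sup>2 * (\<mu> - a i i)" for t
    proof -
      have "(\<Sum>v\<in>V. (x v + t * of_bool (v = i))\<^sup>2)
          = (\<Sum>v\<in>V. (x v)\<^sup>2) + 2 * t * x i + t\<^sup>2"
        using fin i
        by (auto simp: quad_form_identity[symmetric] quad_form_shift_coordinate sum_of_bool_mult_eq)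
      then show ?thesis
        using le[of "\<lambda>v. x v + t * of_bool (v = i)"] x
        by (simp add: K_def quad_form_shift_coordinate[OF fin i sym] \<mu>_def[symmetric] algebra_simps)
    qed
    then have "(\<Sum>j\<in>V. a i j * x j) - \<mu> * x i = 0"
      by (intro eq_zero_if_linear_le_square[of 1]) auto
    then show ?thesis by simp
  qed
  show ?thesis using x le eig by (intro that[of x \<mu>]) (auto simp: K_def)
qed


section \<open>The entropy bound on powers of the largest eigenvalue\<close>

text \<open>For a 0/1 matrix this counts the walks with \<open>m\<close> steps, that is on \<open>m + 1\<close> vertices, starting at
  \<open>i\<close>.\<close>
primrec walk_weight :: "'a set \<Rightarrow> ('a \<Rightarrow> 'a \<Rightarrow> real) \<Rightarrow> nat \<Rightarrow> 'a \<Rightarrow> real" where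
  "walk_weight V a 0 i = 1"
| "walk_weight V a (Suc m) i = (\<Sum>j\<in>V. a i j * walk_weight V a m j)"

locale perron_pair =
  fixes V :: "'a set" and a :: "'a \<Rightarrow> 'a \<Rightarrow> real" and x :: "'a \<Rightarrow> real" and \<mu> :: real
  assumes finite_V: "finite V"
    and sym: "\<And>i j. a i j = a j i"
    and nonneg: "\<And>i j. 0 \<le> a i j"
    and x_nonneg: "\<And>i. i \<in> V \<Longrightarrow> 0 \<le> x i"
    and x_unit: "(\<Sum>i\<in>V. (x i)\<^sup>2) = 1"
    and eigen: "\<And>i. i \<in> V \<Longrightarrow> (\<Sum>j\<in>V. a i j * x j) = \<mu> * x i"
    and \<mu>_pos: "0 < \<mu>"
begin

lemma walk_weight_nonneg: "0 \<le> walk_weight V a m i"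
  by (induction m arbitrary: i) (auto intro!: sum_nonneg mult_nonneg_nonneg nonneg)

text \<open>A vertex with positive eigenvector entry has a neighbour with positive entry, so walks starting there
  can be continued for ever.\<close>
lemma walk_weight_pos:
  assumes "i \<in> V" "0 < x i"
  shows "0 < walk_weight V a m i"
  using assms
proof (induction m arbitrary: i)
  case (Suc m)
  have "(\<Sum>j\<in>V. a i j * x j) \<noteq> 0" using eigen \<mu>_pos Suc.prems by simp
  then obtain j where j: "j \<in> V" "a i j * x j \<noteq> 0" by (meson sum.neutral)
  then have "0 < a i j" "0 < x j" using nonneg x_nonneg by (auto simp: less_le)
  then have "0 < a i j * walk_weight V a m j" using Suc.IH j by simp
  also have "\<dots> \<le> walk_weight V a (Suc m) i"
    using j finite_V by (auto intro!: member_le_sum[of j V "\<lambda>j. a i j * walk_weight V a m j"] mult_nonneg_nonneg nonneg walk_weight_nonneg)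
  finally show ?case .
qed simp

text \<open>The arcs traversed by the stationary Markov chain of maximal entropy: it moves from \<open>i\<close> to \<open>j\<close>
  with probability \<open>a i j * x j / (\<mu> * x i)\<close> and has stationary distribution \<open>x i ^ 2\<close>. Both
  marginals of this distribution on pairs are therefore \<open>x i ^ 2\<close>, and for a 0/1 matrix the entropy
  rate of the chain is \<open>ln \<mu>\<close>.\<close>
definition arc_prob :: "'a \<Rightarrow> 'a \<Rightarrow> real" where
  "arc_prob i j = a i j * x i * x j / \<mu>"

lemma arc_prob_nonneg: "i \<in> V \<Longrightarrow> j \<in> V \<Longrightarrow> 0 \<le> arc_prob i j"
  using \<mu>_pos by (simp add: arc_prob_def nonneg x_nonneg)

lemma arc_prob_row_sum: "i \<in> V \<Longrightarrow> (\<Sum>j\<in>V. arc_prob i j) = (x i)\<^sup>2"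
proof -
  assume i: "i \<in> V"
  have "(\<Sum>j\<in>V. arc_prob i j) = x i / \<mu> * (\<Sum>j\<in>V. a i j * x j)"
    unfolding sum_distrib_left arc_prob_def by (intro sum.cong refl) simp
  also have "\<dots> = (x i)\<^sup>2" using i \<mu>_pos by (simp add: eigen power2_eq_square)
  finally show ?thesis .
qed

lemma arc_prob_sum_fst: "(\<Sum>i\<in>V. \<Sum>j\<in>V. arc_prob i j * f i) = (\<Sum>i\<in>V. (x i)\<^sup>2 * f i)"
  by (simp add: sum_distrib_right[symmetric] arc_prob_row_sum cong: sum.cong)

lemma arc_prob_sum_snd: "(\<Sum>i\<in>V. \<Sum>j\<in>V. arc_prob i j * f j) = (\<Sum>i\<in>V. (x i)\<^sup>2 * f i)"
proof -
  have "arc_prob i j = arc_prob j i" for i j by (simp add: arc_prob_def sym[of i j])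
  then show ?thesis by (subst sum.swap) (simp add: arc_prob_sum_fst)
qed

lemma arc_prob_total: "(\<Sum>i\<in>V. \<Sum>j\<in>V. arc_prob i j) = 1"
  using arc_prob_sum_fst[of "\<lambda>_. 1"] x_unit by simp

text \<open>Applying the matrix once raises the average logarithm by at least \<open>ln \<mu>\<close>. By Jensen's
  inequality for one step of the chain, \<open>ln (g i)\<close> is at least the average over the successors \<open>j\<close> of
  \<open>ln (f j) + ln \<mu> + ln (x i) - ln (x j)\<close>; on averaging over \<open>i\<close> the last two terms cancel, since both
  marginals agree. Jensen's inequality is used in the form \<open>ln t \<le> t - 1\<close>, summed over all pairs.\<close>
lemma entropy_step:
  assumes f_nonneg: "\<And>i. i \<in> V \<Longrightarrow> 0 \<le> f i"
    and f_pos: "\<And>i. i \<in> V \<Longrightarrow> 0 < x i \<Longrightarrow> 0 < f i"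
    and g: "\<And>i. i \<in> V \<Longrightarrow> g i = (\<Sum>j\<in>V. a i j * f j)"
    and g_pos: "\<And>i. i \<in> V \<Longrightarrow> 0 < x i \<Longrightarrow> 0 < g i"
  shows "(\<Sum>i\<in>V. (x i)\<^sup>2 * ln (f i)) + ln \<mu> \<le> (\<Sum>i\<in>V. (x i)\<^sup>2 * ln (g i))"
proof -
  have "arc_prob i j * (ln (f j) + ln \<mu> + ln (x i) - ln (x j) - ln (g i))
      \<le> a i j * (x i)\<^sup>2 * f j / g i - arc_prob i j" if ij: "i \<in> V" "j \<in> V" for i j
  proof (cases "arc_prob i j = 0")
    case True
    have "0 \<le> g i" using ij by (simp add: g sum_nonneg nonneg f_nonneg)
    then show ?thesis using True ij by (simp add: nonneg f_nonneg)
  next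
    case False
    then have pos: "0 < x i" "0 < x j" "0 < a i j"
      using ij x_nonneg nonneg by (auto simp: arc_prob_def less_le)
    have fg: "0 < f j" "0 < g i" using f_pos g_pos ij pos by auto
    \<comment> \<open>the exponential of the bracket in the claim\<close>
    let ?t = "f j * \<mu> * x i / (x j * g i)"
    have "ln ?t = ln (f j) + ln \<mu> + ln (x i) - ln (x j) - ln (g i)"
      using pos fg \<mu>_pos by (simp add: ln_div ln_mult)
    moreover have "ln ?t \<le> ?t - 1"
      using pos fg \<mu>_pos by (intro ln_le_minus_one) simp
    ultimately have "arc_prob i j * (ln (f j) + ln \<mu> + ln (x i) - ln (x j) - ln (g i)) \<le> arc_prob i j * (?t - 1)"
      using arc_prob_nonneg[OF ij] by (intro mult_left_mono) auto
    also have "\<dots> = a i j * (x i)\<^sup>2 * f j / g i - arc_prob i j"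
      using pos fg \<mu>_pos by (simp add: arc_prob_def field_simps power2_eq_square)
    finally show ?thesis .
  qed
  then have "(\<Sum>i\<in>V. \<Sum>j\<in>V. arc_prob i j * (ln (f j) + ln \<mu> + ln (x i) - ln (x j) - ln (g i)))
      \<le> (\<Sum>i\<in>V. \<Sum>j\<in>V. a i j * (x i)\<^sup>2 * f j / g i - arc_prob i j)"
    by (intro sum_mono)
  also have "\<dots> = (\<Sum>i\<in>V. \<Sum>j\<in>V. a i j * (x i)\<^sup>2 * f j / g i) - 1"
    by (simp add: sum_subtractf arc_prob_total)
  also have "(\<Sum>i\<in>V. \<Sum>j\<in>V. a i j * (x i)\<^sup>2 * f j / g i) = (\<Sum>i\<in>V. (x i)\<^sup>2)"
  proof (intro sum.cong refl)
    fix i assume i: "i \<in> V"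
    have "(\<Sum>j\<in>V. a i j * (x i)\<^sup>2 * f j / g i) = (x i)\<^sup>2 / g i * g i"
      unfolding g[OF i] sum_distrib_left by (intro sum.cong refl) simp
    then show "(\<Sum>j\<in>V. a i j * (x i)\<^sup>2 * f j / g i) = (x i)\<^sup>2"
      using g_pos[OF i] x_nonneg[OF i] by (cases "x i = 0") auto
  qed
  also have "(\<Sum>i\<in>V. \<Sum>j\<in>V. arc_prob i j * (ln (f j) + ln \<mu> + ln (x i) - ln (x j) - ln (g i)))
      = (\<Sum>i\<in>V. (x i)\<^sup>2 * ln (f i)) + ln \<mu> - (\<Sum>i\<in>V. (x i)\<^sup>2 * ln (g i))"
    by (simp only: right_diff_distrib distrib_left sum.distrib sum_subtractf arc_prob_sum_fst arc_prob_sum_snd)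
       (simp add: sum_distrib_right[symmetric] x_unit)
  finally show ?thesis using x_unit by simp
qed

text \<open>For a 0/1 matrix: given its start, a run of \<open>m\<close> steps of the chain has entropy \<open>m * ln \<mu>\<close>, which
  cannot exceed the average logarithm of the number of walks available.\<close>
lemma entropy_le_log_walk_weight:
  "real m * ln \<mu> \<le> (\<Sum>i\<in>V. (x i)\<^sup>2 * ln (walk_weight V a m i))"
proof (induction m)
  case (Suc m)
  have "(\<Sum>i\<in>V. (x i)\<^sup>2 * ln (walk_weight V a m i)) + ln \<mu>
      \<le> (\<Sum>i\<in>V. (x i)\<^sup>2 * ln (walk_weight V a (Suc m) i))"
    by (intro entropy_step walk_weight_nonneg walk_weight_pos walk_weight.simps)
  with Suc show ?case by (simp add: algebra_simps)
qed simp

text \<open>Jensen's inequality once more, for the pair distribution and the function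
  \<open>sqrt (w i * w j)\<close>: the average of its logarithm equals the average of \<open>ln (w i)\<close>, which is at
  least \<open>m * ln \<mu>\<close>. This is the step that lets one bilinear expression over the edges dominate the
  full power of the eigenvalue.\<close>
lemma power_le_quad_form_walk_weight:
  "\<mu> ^ Suc m \<le> quad_form V a (\<lambda>i. x i * sqrt (walk_weight V a m i))"
proof -
  let ?w = "walk_weight V a m"
  define q where "q i j = arc_prob i j * sqrt (?w i * ?w j)" for i j
  define Q where "Q = (\<Sum>i\<in>V. \<Sum>j\<in>V. q i j)"
  have q_nonneg: "0 \<le> q i j" if "i \<in> V" "j \<in> V" for i j
    using that by (simp add: q_def arc_prob_nonneg walk_weight_nonneg)
  have "\<exists>i\<in>V. \<exists>j\<in>V. arc_prob i j \<noteq> 0"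
  proof (rule ccontr)
    assume "\<not> ?thesis"
    then have "\<forall>i\<in>V. \<forall>j\<in>V. arc_prob i j = 0" by simp
    then show False using arc_prob_total by simp
  qed
  then obtain i j where ij: "i \<in> V" "j \<in> V" "arc_prob i j \<noteq> 0" by auto
  have w_pos: "0 < ?w i" if "i \<in> V" "j \<in> V" "arc_prob i j \<noteq> 0 \<or> arc_prob j i \<noteq> 0" for i j
    using that x_nonneg by (intro walk_weight_pos) (auto simp: arc_prob_def less_le)
  have "0 < q i j"
    using ij w_pos[of i j] w_pos[of j i] arc_prob_nonneg[of i j] by (simp add: q_def less_le)
  also have "q i j \<le> (\<Sum>j\<in>V. q i j)"
    using ij finite_V q_nonneg by (intro member_le_sum) auto
  also have "\<dots> \<le> Q" unfolding Q_def
    using ij finite_V q_nonneg by (intro member_le_sum[of i V "\<lambda>i. \<Sum>j\<in>V. q i j"]) (auto intro!: sum_nonneg)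
  finally have Q_pos: "0 < Q" .
  have "arc_prob i j * (ln (?w i) / 2 + ln (?w j) / 2 - ln Q) \<le> q i j / Q - arc_prob i j"
    if ij: "i \<in> V" "j \<in> V" for i j
  proof (cases "arc_prob i j = 0")
    case True
    then show ?thesis by (simp add: q_def)
  next
    case False
    have w: "0 < ?w i" "0 < ?w j" using w_pos[of i j] w_pos[of j i] ij False by auto
    have "ln (sqrt (?w i * ?w j) / Q) = ln (?w i) / 2 + ln (?w j) / 2 - ln Q"
      using w Q_pos by (simp add: ln_div ln_mult ln_sqrt field_simps)
    moreover have "ln (sqrt (?w i * ?w j) / Q) \<le> sqrt (?w i * ?w j) / Q - 1"
      using w Q_pos by (intro ln_le_minus_one) simp
    ultimately have "arc_prob i j * (ln (?w i) / 2 + ln (?w j) / 2 - ln Q) \<le> arc_prob i j * (sqrt (?w i * ?w j) / Q - 1)"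
      using arc_prob_nonneg[OF ij] by (intro mult_left_mono) auto
    then show ?thesis by (simp add: q_def right_diff_distrib)
  qed
  then have "(\<Sum>i\<in>V. \<Sum>j\<in>V. arc_prob i j * (ln (?w i) / 2 + ln (?w j) / 2 - ln Q))
      \<le> (\<Sum>i\<in>V. \<Sum>j\<in>V. q i j / Q - arc_prob i j)"
    by (intro sum_mono)
  also have "\<dots> = 0"
    using Q_pos by (simp add: sum_subtractf arc_prob_total sum_divide_distrib[symmetric] Q_def)
  also have "(\<Sum>i\<in>V. \<Sum>j\<in>V. arc_prob i j * (ln (?w i) / 2 + ln (?w j) / 2 - ln Q))
      = (\<Sum>i\<in>V. \<Sum>j\<in>V. arc_prob i j * (ln (?w i) / 2)) + (\<Sum>i\<in>V. \<Sum>j\<in>V. arc_prob i j * (ln (?w j) / 2))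
        - (\<Sum>i\<in>V. \<Sum>j\<in>V. arc_prob i j) * ln Q"
    by (simp only: right_diff_distrib distrib_left sum.distrib sum_subtractf sum_distrib_right)
  also have "\<dots> = (\<Sum>i\<in>V. (x i)\<^sup>2 * ln (?w i)) - ln Q"
    by (simp only: arc_prob_sum_fst arc_prob_sum_snd arc_prob_total) (simp add: sum_divide_distrib[symmetric])
  finally have "real m * ln \<mu> \<le> ln Q"
    using entropy_le_log_walk_weight[of m] by linarith
  then have "ln (\<mu> ^ m) \<le> ln Q" using \<mu>_pos by (simp add: ln_realpow)
  then have "\<mu> ^ m \<le> Q" using \<mu>_pos Q_pos by (subst (asm) ln_le_cancel_iff) auto
  then have "\<mu> ^ Suc m \<le> \<mu> * Q" using \<mu>_pos by simp
  also have "\<mu> * Q = quad_form V a (\<lambda>i. x i * sqrt (?w i))"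
    unfolding Q_def quad_form_def sum_distrib_left q_def arc_prob_def using \<mu>_pos
    by (intro sum.cong refl) (simp add: real_sqrt_mult)
  finally show ?thesis .
qed

text \<open>Both sides are the pairing of \<open>x\<close> with the \<open>m\<close>-th power of the matrix applied to the all-one
  vector.\<close>
lemma sum_walk_weight_mult_perron:
  "(\<Sum>i\<in>V. walk_weight V a m i * x i) = \<mu> ^ m * (\<Sum>i\<in>V. x i)"
proof (induction m)
  case (Suc m)
  have "(\<Sum>i\<in>V. walk_weight V a (Suc m) i * x i)
      = (\<Sum>i\<in>V. \<Sum>j\<in>V. a i j * walk_weight V a m j * x i)"
    by (simp add: sum_distrib_right)
  also have "\<dots> = (\<Sum>j\<in>V. \<Sum>i\<in>V. a i j * walk_weight V a m j * x i)"
    by (rule sum.swap)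
  also have "\<dots> = (\<Sum>j\<in>V. walk_weight V a m j * (\<Sum>i\<in>V. a j i * x i))"
    unfolding sum_distrib_left
  proof (intro sum.cong refl)
    fix i j show "a i j * walk_weight V a m j * x i = walk_weight V a m j * (a j i * x i)"
      using sym[of i j] by simp
  qed
  also have "\<dots> = (\<Sum>j\<in>V. walk_weight V a m j * (\<mu> * x j))"
    by (intro sum.cong refl) (simp add: eigen)
  also have "\<dots> = \<mu> * (\<Sum>j\<in>V. walk_weight V a m j * x j)"
    unfolding sum_distrib_left by (intro sum.cong refl) simp
  finally show ?case using Suc by simp
qed simp

end


section \<open>Symmetrization and its extremal vectors\<close>

text \<open>Zykov symmetrization. Moving weight between two nonadjacent vertices keeps the total and
  changes the form linearly, so all the weight of one of them can be moved to the other without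
  decreasing the form. Each such move shrinks the set of vertices carrying weight, and the process
  stops at a clique.\<close>
lemma quad_form_le_square_if_cliques:
  fixes b :: "'a \<Rightarrow> 'a \<Rightarrow> real"
  assumes fin: "finite V" and sym: "\<And>i j. b i j = b j i" and diag: "\<And>i. b i i = 0"
    and cliques: "\<And>K z. K \<subseteq> V \<Longrightarrow> (\<forall>i\<in>K. \<forall>j\<in>K. i \<noteq> j \<longrightarrow> b i j \<noteq> 0) \<Longrightarrow> (\<forall>i\<in>K. 0 \<le> z i)
                   \<Longrightarrow> quad_form K b z \<le> (\<Sum>i\<in>K. z i)\<^sup>2"
    and z: "\<forall>i\<in>V. 0 \<le> z i"
  shows "quad_form V b z \<le> (\<Sum>i\<in>V. z i)\<^sup>2"
  using z
proof (induction "card {i \<in> V. z i \<noteq> 0}" arbitrary: z rule: less_induct)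
  case less
  define S where "S = {i \<in> V. z i \<noteq> 0}"
  have S: "finite S" "S \<subseteq> V" using fin by (auto simp: S_def)
  show ?case
  proof (cases "\<forall>i\<in>S. \<forall>j\<in>S. i \<noteq> j \<longrightarrow> b i j \<noteq> 0")
    case True
    have "quad_form V b z = quad_form S b z"
    proof -
      have "(\<Sum>i\<in>V. \<Sum>j\<in>V. b i j * z i * z j) = (\<Sum>i\<in>S. \<Sum>j\<in>V. b i j * z i * z j)"
        using fin S by (intro sum.mono_neutral_right) (auto simp: S_def)
      also have "\<dots> = (\<Sum>i\<in>S. \<Sum>j\<in>S. b i j * z i * z j)"
        using fin S by (intro sum.cong refl sum.mono_neutral_right) (auto simp: S_def)
      finally show ?thesis by (simp add: quad_form_def)
    qed
    also have "\<dots> \<le> (\<Sum>i\<in>S. z i)\<^sup>2"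
      using True S less.prems by (intro cliques) auto
    also have "(\<Sum>i\<in>S. z i) = (\<Sum>i\<in>V. z i)"
      using fin S by (intro sum.mono_neutral_left) (auto simp: S_def)
    finally show ?thesis .
  next
    case False
    define \<beta> where "\<beta> i = (\<Sum>k\<in>V. b i k * z k)" for i
    have "\<exists>i\<in>S. \<exists>j\<in>S. i \<noteq> j \<and> b i j = 0 \<and> \<beta> j \<le> \<beta> i"
    proof -
      obtain i j where "i \<in> S" "j \<in> S" "i \<noteq> j" "b i j = 0" using False by auto
      moreover have "b j i = 0" using sym[of i j] calculation(4) by simp
      ultimately show ?thesis using linear[of "\<beta> i" "\<beta> j"] by metis
    qed
    then obtain i j where ij: "i \<in> S" "j \<in> S" "i \<noteq> j" "b i j = 0" "\<beta> j \<le> \<beta> i" by auto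
    have V: "i \<in> V" "j \<in> V" using ij S by auto
    have zj: "0 \<le> z j" "0 \<le> z i" "z i \<noteq> 0" using less.prems V ij by (auto simp: S_def)
    \<comment> \<open>move the weight of \<open>j\<close> to the vertex with the larger row sum, in two coordinate steps\<close>
    define y where "y = (\<lambda>v. z v + z j * of_bool (v = i))"
    define z' where "z' = (\<lambda>v. y v + (- z j) * of_bool (v = j))"
    have qy: "quad_form V b y = quad_form V b z + 2 * z j * \<beta> i"
      unfolding y_def quad_form_shift_coordinate[OF fin V(1) sym] \<beta>_def by (simp add: diag)
    have "(\<Sum>k\<in>V. b j k * y k) = \<beta> j"
      unfolding y_def sum_shift_coordinate[OF fin V(1)] \<beta>_def using ij(4) sym[of i j] by simp
    then have "quad_form V b z' = quad_form V b y - 2 * z j * \<beta> j"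
      unfolding z'_def quad_form_shift_coordinate[OF fin V(2) sym] by (simp add: diag)
    then have q: "quad_form V b z \<le> quad_form V b z'"
      using qy mult_left_mono[OF ij(5), of "2 * z j"] zj by simp
    have s: "(\<Sum>v\<in>V. z' v) = (\<Sum>v\<in>V. z v)"
    proof -
      have "(\<Sum>v\<in>V. y v) = (\<Sum>v\<in>V. z v) + z j"
        unfolding y_def using sum_shift_coordinate[OF fin V(1), of "\<lambda>_. 1" z "z j"] by simp
      moreover have "(\<Sum>v\<in>V. z' v) = (\<Sum>v\<in>V. y v) + - z j"
        unfolding z'_def using sum_shift_coordinate[OF fin V(2), of "\<lambda>_. 1" y "- z j"] by simp
      ultimately show ?thesis by simp
    qed
    have "{v \<in> V. z' v \<noteq> 0} \<subset> S"
    proof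
      show "{v \<in> V. z' v \<noteq> 0} \<subseteq> S"
        using ij by (auto simp: S_def z'_def y_def split: if_splits)
      have "j \<notin> {v \<in> V. z' v \<noteq> 0}" using ij by (simp add: z'_def y_def)
      then show "{v \<in> V. z' v \<noteq> 0} \<noteq> S" using ij by metis
    qed
    then have "card {v \<in> V. z' v \<noteq> 0} < card {i \<in> V. z i \<noteq> 0}"
      using S(1) psubset_card_mono unfolding S_def by metis
    moreover have "\<forall>v\<in>V. 0 \<le> z' v"
      using less.prems zj ij(3) by (auto simp: z'_def y_def of_bool_def)
    ultimately have "quad_form V b z' \<le> (\<Sum>v\<in>V. z' v)\<^sup>2" by (rule less.hyps)
    then show ?thesis using q s by simp
  qed
qed

text \<open>On \<open>k\<close> vertices the Cauchy--Schwarz inequality gives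
  \<open>(\<Sum> z)^2 - \<Sum> z^2 \<le> (1 - 1/k) (\<Sum> z)^2\<close>, and the bound on the entries is the reciprocal of that
  factor.\<close>
lemma quad_form_le_square_clique:
  fixes b :: "'a \<Rightarrow> 'a \<Rightarrow> real"
  assumes fin: "finite K" and diag: "\<And>i. b i i = 0"
    and le: "\<And>i j. i \<in> K \<Longrightarrow> j \<in> K \<Longrightarrow> i \<noteq> j \<Longrightarrow> b i j \<le> real (card K) / (real (card K) - 1)"
    and z: "\<forall>i\<in>K. 0 \<le> z i"
  shows "quad_form K b z \<le> (\<Sum>i\<in>K. z i)\<^sup>2"
proof (cases "card K \<le> 1")
  case True
  then have "\<forall>i\<in>K. \<forall>j\<in>K. i = j" using fin by (simp add: card_le_Suc0_iff_eq)
  then have "quad_form K b z = 0"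
    unfolding quad_form_def by (intro sum.neutral ballI) (metis diag mult_zero_left)
  then show ?thesis by simp
next
  case False
  define k where "k = real (card K)"
  have k: "k > 1" using False by (simp add: k_def)
  define c where "c = k / (k - 1)"
  have "quad_form K b z \<le> (\<Sum>i\<in>K. \<Sum>j\<in>K. c * (z i * z j) - c * (if i = j then z i * z j else 0))"
    unfolding quad_form_def
  proof (intro sum_mono)
    fix i j assume ij: "i \<in> K" "j \<in> K"
    show "b i j * z i * z j \<le> c * (z i * z j) - c * (if i = j then z i * z j else 0)"
    proof (cases "i = j")
      case False
      then have "b i j * (z i * z j) \<le> c * (z i * z j)"
        using le[OF ij] z ij by (intro mult_right_mono) (auto simp: c_def k_def)
      then show ?thesis using False by simp
    qed (simp add: diag)
  qed
  also have "\<dots> = c * ((\<Sum>i\<in>K. z i)\<^sup>2 - (\<Sum>i\<in>K. (z i)\<^sup>2))"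
    using fin by (simp add: sum_subtractf sum_distrib_left[symmetric] sum_product power2_eq_square
        right_diff_distrib)
  also have "\<dots> \<le> (\<Sum>i\<in>K. z i)\<^sup>2"
  proof -
    have "(\<Sum>i\<in>K. z i)\<^sup>2 \<le> (\<Sum>i\<in>K. (z i)\<^sup>2) * k"
      unfolding k_def by (rule sum_squared_le_sum_of_squares)
    then show ?thesis using k by (simp add: c_def field_simps)
  qed
  finally show ?thesis .
qed

text \<open>The second-order condition at a maximizer that is positive on \<open>i\<close>, \<open>j\<close>, \<open>k\<close>: the direction
  that adds \<open>t\<close> at \<open>i\<close> and \<open>k\<close> and removes \<open>2 * t\<close> at \<open>j\<close> keeps the total, so by the parallelogram law
  the form is at most zero on it. If \<open>j\<close> is adjacent to neither \<open>i\<close> nor \<open>k\<close>, the form there is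
  \<open>2 * t ^ 2 * b i k\<close>.\<close>
lemma not_adjacent_trans_if_extremal:
  fixes b :: "'a \<Rightarrow> 'a \<Rightarrow> real"
  assumes fin: "finite V" and sym: "\<And>i j. b i j = b j i" and diag: "\<And>i. b i i = 0"
    and bound: "\<And>z. \<forall>i\<in>V. 0 \<le> z i \<Longrightarrow> quad_form V b z \<le> (\<Sum>i\<in>V. z i)\<^sup>2"
    and z: "\<forall>i\<in>V. 0 \<le> z i" and eq: "quad_form V b z = (\<Sum>i\<in>V. z i)\<^sup>2"
    and V: "i \<in> V" "j \<in> V" "k \<in> V" and pos: "0 < z i" "0 < z j" "0 < z k"
    and ij: "b i j = 0" and jk: "b j k = 0"
  shows "b i k \<le> 0"
proof -
  \<comment> \<open>both \<open>z + h\<close> and \<open>z - h\<close> must stay nonnegative, and \<open>h\<close> takes \<open>2 * t\<close> at \<open>j\<close>\<close>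
  define t where "t = min (z i) (min (z j) (z k)) / 2"
  have t: "0 < t" "2 * t \<le> z i" "2 * t \<le> z j" "2 * t \<le> z k"
    using pos by (auto simp: t_def)
  define h1 where "h1 = (\<lambda>v. 0 + t * of_bool (v = i))"
  define h2 where "h2 = (\<lambda>v. h1 v + t * of_bool (v = k))"
  define h where "h = (\<lambda>v. h2 v + (- 2 * t) * of_bool (v = j))"
  have bji: "b j i = 0" "b k i = b i k" using ij sym[of i j] sym[of i k] by auto
  have q1: "quad_form V b h1 = 0"
    unfolding h1_def quad_form_shift_coordinate[OF fin V(1) sym] by (simp add: diag quad_form_def)
  have r1: "(\<Sum>v\<in>V. c v * h1 v) = t * c i" for c
    unfolding h1_def sum_shift_coordinate[OF fin V(1)] by simp
  have q2: "quad_form V b h2 = 2 * t\<^sup>2 * b i k"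
    unfolding h2_def quad_form_shift_coordinate[OF fin V(3) sym] r1 q1
    by (simp add: diag bji power2_eq_square)
  have r2: "(\<Sum>v\<in>V. c v * h2 v) = t * c i + t * c k" for c
    unfolding h2_def sum_shift_coordinate[OF fin V(3)] r1 by simp
  have q: "quad_form V b h = 2 * t\<^sup>2 * b i k"
    unfolding h_def quad_form_shift_coordinate[OF fin V(2) sym] r2 q2 by (simp add: diag bji jk)
  have s: "(\<Sum>v\<in>V. h v) = 0"
    using sum_shift_coordinate[OF fin V(2), of "\<lambda>_. 1" h2 "- 2 * t"] r2[of "\<lambda>_. 1"]
    by (simp add: h_def)
  have h_bound: "0 \<le> z v + h v" "0 \<le> z v - h v" if "v \<in> V" for v
    using that z t by (auto simp: h_def h2_def h1_def of_bool_def)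
  have "quad_form V b (\<lambda>v. z v + h v) \<le> (\<Sum>v\<in>V. z v + h v)\<^sup>2"
    using h_bound by (intro bound) auto
  moreover have "quad_form V b (\<lambda>v. z v - h v) \<le> (\<Sum>v\<in>V. z v - h v)\<^sup>2"
    using h_bound by (intro bound) auto
  ultimately have "quad_form V b h \<le> 0"
    using quad_form_parallelogram[of V b z h] eq s by (simp add: sum.distrib sum_subtractf)
  then show ?thesis using q t by (simp add: mult_le_0_iff)
qed

lemma row_sum_eq_if_extremal:
  fixes b :: "'a \<Rightarrow> 'a \<Rightarrow> real"
  assumes fin: "finite V" and sym: "\<And>i j. b i j = b j i" and diag: "\<And>i. b i i = 0"
    and bound: "\<And>z. \<forall>i\<in>V. 0 \<le> z i \<Longrightarrow> quad_form V b z \<le> (\<Sum>i\<in>V. z i)\<^sup>2"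
    and z: "\<forall>i\<in>V. 0 \<le> z i" and eq: "quad_form V b z = (\<Sum>i\<in>V. z i)\<^sup>2"
    and i: "i \<in> V" "0 < z i"
  shows "(\<Sum>j\<in>V. b i j * z j) = (\<Sum>j\<in>V. z j)"
proof -
  have "2 * t * ((\<Sum>j\<in>V. b i j * z j) - (\<Sum>j\<in>V. z j)) \<le> t\<^sup>2 * 1" if "\<bar>t\<bar> \<le> z i" for t
  proof -
    have "quad_form V b (\<lambda>v. z v + t * of_bool (v = i)) \<le> (\<Sum>v\<in>V. z v + t * of_bool (v = i))\<^sup>2"
      using z that by (intro bound) (auto simp: of_bool_def)
    also have "(\<Sum>v\<in>V. z v + t * of_bool (v = i)) = (\<Sum>v\<in>V. z v) + t"
      using sum_shift_coordinate[OF fin i(1), of "\<lambda>_. 1"] by simp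
    finally show ?thesis
      unfolding quad_form_shift_coordinate[OF fin i(1) sym] eq
      by (simp add: diag power2_eq_square algebra_simps)
  qed
  then have "(\<Sum>j\<in>V. b i j * z j) - (\<Sum>j\<in>V. z j) = 0"
    using i(2) by (intro eq_zero_if_linear_le_square)
  then show ?thesis by simp
qed


section \<open>The walk inequality for abstract weights\<close>

text \<open>The inequality and the necessary conditions for equality depend on the clique structure of the graph
  only through weights \<open>\<phi>\<close> for which the Motzkin--Straus bound holds. The parameter \<open>m\<close> is the number of steps of the walks.\<close>
locale motzkin_straus_weights = perron_pair +
  fixes \<phi> :: "'a \<Rightarrow> real" and m :: nat
  assumes \<phi>_nonneg: "\<And>i. 0 \<le> \<phi> i"
    and \<phi>_pos: "\<And>i j. i \<in> V \<Longrightarrow> j \<in> V \<Longrightarrow> a i j \<noteq> 0 \<Longrightarrow> 0 < \<phi> i"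
    and no_loops: "\<And>i. a i i = 0"
    and motzkin_straus: "\<And>z. \<forall>i\<in>V. 0 \<le> z i \<Longrightarrow>
      quad_form V (\<lambda>i j. a i j / (sqrt (\<phi> i) * sqrt (\<phi> j))) z \<le> (\<Sum>i\<in>V. z i)\<^sup>2"
begin

abbreviation "w \<equiv> walk_weight V a m"
definition "scaled i j = a i j / (sqrt (\<phi> i) * sqrt (\<phi> j))"
definition "walk_total = (\<Sum>i\<in>V. w i * \<phi> i)"
definition "test_vec i = x i * sqrt (w i * \<phi> i)"

lemma scaled_sym: "scaled i j = scaled j i"
  by (simp add: scaled_def sym[of i j])

lemma scaled_diag: "scaled i i = 0"
  by (simp add: scaled_def no_loops)

lemma scaled_bound: "\<forall>i\<in>V. 0 \<le> z i \<Longrightarrow> quad_form V scaled z \<le> (\<Sum>i\<in>V. z i)\<^sup>2"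
  using motzkin_straus[of z] by (simp add: scaled_def[abs_def])

lemma test_vec_nonneg: "\<forall>i\<in>V. 0 \<le> test_vec i"
  by (simp add: test_vec_def x_nonneg walk_weight_nonneg \<phi>_nonneg)

text \<open>The substitution that turns the adjacency form into the scaled one. Where \<open>\<phi>\<close> vanishes there are no
  arcs, so division by zero is harmless.\<close>
lemma scaled_mult:
  assumes "i \<in> V" "j \<in> V"
  shows "scaled i j * (sqrt (\<phi> i) * s) * (sqrt (\<phi> j) * t) = a i j * s * t"
proof (cases "a i j = 0")
  case False
  then have "0 < \<phi> i" "0 < \<phi> j" using assms \<phi>_pos[of i j] \<phi>_pos[of j i] sym[of i j] by auto
  then show ?thesis by (simp add: scaled_def)
qed (simp add: scaled_def)

lemma power_le_quad_form_test_vec: "\<mu> ^ Suc m \<le> quad_form V scaled test_vec"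
proof -
  have "quad_form V a (\<lambda>i. x i * sqrt (w i)) = quad_form V scaled test_vec"
    unfolding quad_form_def
  proof (intro sum.cong refl)
    fix i j assume "i \<in> V" "j \<in> V"
    then show "a i j * (x i * sqrt (w i)) * (x j * sqrt (w j)) = scaled i j * test_vec i * test_vec j"
      using scaled_mult[of i j "x i * sqrt (w i)" "x j * sqrt (w j)"]
      by (simp only: test_vec_def real_sqrt_mult mult_ac)
  qed
  then show ?thesis using power_le_quad_form_walk_weight[of m] by simp
qed

lemma total_nonneg: "0 \<le> walk_total"
  unfolding walk_total_def by (intro sum_nonneg mult_nonneg_nonneg walk_weight_nonneg \<phi>_nonneg)

lemma sum_test_vec_le_walk_total: "(\<Sum>i\<in>V. test_vec i)\<^sup>2 \<le> walk_total"
proof -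
  have "(\<Sum>i\<in>V. test_vec i)\<^sup>2 \<le> (\<Sum>i\<in>V. (x i)\<^sup>2) * (\<Sum>i\<in>V. (sqrt (w i * \<phi> i))\<^sup>2)"
    unfolding test_vec_def by (rule Cauchy_Schwarz_ineq_sum)
  then show ?thesis by (simp add: x_unit walk_total_def walk_weight_nonneg \<phi>_nonneg)
qed

text \<open>The chain of three inequalities: entropy, Motzkin--Straus and Cauchy--Schwarz, the last one against
  the unit vector \<open>x\<close>.\<close>
theorem power_le_walk_total: "\<mu> ^ Suc m \<le> walk_total"
  using power_le_quad_form_test_vec scaled_bound[OF test_vec_nonneg] sum_test_vec_le_walk_total by linarith

context
  assumes equality: "\<mu> ^ Suc m = walk_total"
    and walk_weight_pos_of_weight: "\<And>i. i \<in> V \<Longrightarrow> 0 < \<phi> i \<Longrightarrow> 0 < w i"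
begin

lemma quad_form_test_vec_eq: "quad_form V scaled test_vec = (\<Sum>i\<in>V. test_vec i)\<^sup>2"
  and sum_test_vec_eq: "(\<Sum>i\<in>V. test_vec i)\<^sup>2 = walk_total"
  using equality power_le_quad_form_test_vec scaled_bound[OF test_vec_nonneg] sum_test_vec_le_walk_total by linarith+

lemma sum_test_vec_eq_sqrt: "(\<Sum>i\<in>V. test_vec i) = sqrt walk_total"
  using sum_test_vec_eq test_vec_nonneg by (intro real_sqrt_unique[symmetric] sum_nonneg) auto

text \<open>Equality in the Cauchy--Schwarz inequality forces proportionality, and the unit norm of \<open>x\<close> fixes the
  factor.\<close>
lemma sqrt_walk_eq:
  assumes "i \<in> V"
  shows "sqrt (w i * \<phi> i) = sqrt walk_total * x i"
proof -
  let ?y = "\<lambda>i. sqrt (w i * \<phi> i)"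
  have "(\<Sum>i\<in>V. (?y i - sqrt walk_total * x i)\<^sup>2)
      = (\<Sum>i\<in>V. w i * \<phi> i) - 2 * sqrt walk_total * (\<Sum>i\<in>V. test_vec i) + walk_total * (\<Sum>i\<in>V. (x i)\<^sup>2)"
    unfolding sum_distrib_left sum_subtractf[symmetric] sum.distrib[symmetric]
    by (intro sum.cong refl)
       (simp add: power2_diff power_mult_distrib test_vec_def walk_weight_nonneg \<phi>_nonneg total_nonneg)
  also have "\<dots> = 0"
    using total_nonneg by (simp add: x_unit sum_test_vec_eq_sqrt walk_total_def[symmetric])
  finally show ?thesis
    using finite_V assms by (simp add: sum_nonneg_eq_0_iff)
qed

lemma square_perron_eq: "i \<in> V \<Longrightarrow> walk_total * (x i)\<^sup>2 = w i * \<phi> i"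
  using sqrt_walk_eq[of i] total_nonneg walk_weight_nonneg \<phi>_nonneg
  by (metis mult_nonneg_nonneg power_mult_distrib real_sqrt_pow2)

lemma x_pos: "i \<in> V \<Longrightarrow> 0 < \<phi> i \<Longrightarrow> 0 < x i"
  using square_perron_eq[of i] walk_weight_pos_of_weight[of i] x_nonneg[of i] by (auto simp: less_le)

lemma test_vec_pos: "i \<in> V \<Longrightarrow> 0 < \<phi> i \<Longrightarrow> 0 < test_vec i"
  by (simp add: test_vec_def x_pos walk_weight_pos_of_weight)

text \<open>The test vector is an extremal vector of the Motzkin--Straus bound with no zero entry where \<open>\<phi>\<close> is
  positive, so the second-order condition applies to every triple of such vertices.\<close>
lemma nonadjacency_trans:
  assumes "i \<in> V" "j \<in> V" "k \<in> V" "0 < \<phi> i" "0 < \<phi> j" "0 < \<phi> k" "a i j = 0" "a j k = 0"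
  shows "a i k = 0"
proof -
  have "scaled i k \<le> 0"
    using assms(7,8)
    by (intro not_adjacent_trans_if_extremal[OF finite_V scaled_sym scaled_diag scaled_bound test_vec_nonneg quad_form_test_vec_eq
          assms(1-3)] test_vec_pos assms(1-6)) (auto simp: scaled_def)
  then have "a i k \<le> 0" using assms by (auto simp: scaled_def divide_le_0_iff mult_le_0_iff)
  then show ?thesis using nonneg[of i k] by simp
qed

text \<open>The first-order condition at the test vector, with the eigenvector entries eliminated. When \<open>\<phi>\<close>
  is constant where it is positive, this says that the number of walks with one more step does not
  depend on the starting vertex.\<close>
lemma weighted_walk_sum:
  assumes i: "i \<in> V" "0 < \<phi> i"
  shows "(\<Sum>j\<in>V. a i j * (w j * sqrt (\<phi> j))) = sqrt (\<phi> i) * walk_total"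
proof -
  have zw: "sqrt walk_total * test_vec j = w j * \<phi> j" if "j \<in> V" for j
  proof -
    have "sqrt walk_total * test_vec j = sqrt (w j * \<phi> j) * sqrt (w j * \<phi> j)"
      using sqrt_walk_eq[OF that] by (simp add: test_vec_def)
    then show ?thesis by (simp add: walk_weight_nonneg \<phi>_nonneg)
  qed
  have "(\<Sum>j\<in>V. scaled i j * test_vec j) = sqrt walk_total"
    using row_sum_eq_if_extremal[OF finite_V scaled_sym scaled_diag scaled_bound test_vec_nonneg quad_form_test_vec_eq i(1) test_vec_pos[OF i]]
      sum_test_vec_eq_sqrt by simp
  then have "sqrt (\<phi> i) * sqrt walk_total * (\<Sum>j\<in>V. scaled i j * test_vec j) = sqrt (\<phi> i) * walk_total"
    using total_nonneg by simp
  also have "sqrt (\<phi> i) * sqrt walk_total * (\<Sum>j\<in>V. scaled i j * test_vec j) = (\<Sum>j\<in>V. sqrt (\<phi> i) * (scaled i j * (sqrt walk_total * test_vec j)))"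
    unfolding sum_distrib_left by (intro sum.cong refl) simp
  also have "\<dots> = (\<Sum>j\<in>V. a i j * (w j * sqrt (\<phi> j)))"
  proof (intro sum.cong refl)
    fix j assume j: "j \<in> V"
    have e: "sqrt walk_total * test_vec j = sqrt (\<phi> j) * (w j * sqrt (\<phi> j))"
      using \<phi>_nonneg[of j] zw[OF j] by simp
    show "sqrt (\<phi> i) * (scaled i j * (sqrt walk_total * test_vec j)) = a i j * (w j * sqrt (\<phi> j))"
      unfolding e using scaled_mult[OF i(1) j, of 1 "w j * sqrt (\<phi> j)"]
      by (simp only: mult_1_right mult_1_left mult_ac)
  qed
  finally show ?thesis .
qed

end

end


section \<open>Walks and the largest eigenvalue of a graph\<close>

definition adjacency :: "('a, 'b) pre_digraph \<Rightarrow> 'a \<Rightarrow> 'a \<Rightarrow> real" where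
  "adjacency G u v = of_bool (u \<rightarrow>\<^bsub>G\<^esub> v)"

lemma arcs_ends_induce_subgraph:
  "arcs_ends (G \<restriction> S) = arcs_ends G \<inter> S \<times> S"
  by (auto simp: arcs_ends_conv)

lemma vwalk_Cons_iff:
  "vwalk (u # p) G \<longleftrightarrow> u \<in> verts G \<and> (p = [] \<or> (u \<rightarrow>\<^bsub>G\<^esub> hd p \<and> vwalk p G))"
  by (cases p) (auto simp: vwalk_def)

context graph
begin

lemma adjacent_sym: "u \<rightarrow>\<^bsub>G\<^esub> v \<Longrightarrow> v \<rightarrow>\<^bsub>G\<^esub> u"
  using arcs_ends_symmetric[OF sym_arcs] .

lemma adjacency_sym: "adjacency G u v = adjacency G v u"
  using adjacent_sym by (auto simp: adjacency_def)

lemma adjacency_nonneg: "0 \<le> adjacency G u v"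
  by (simp add: adjacency_def)

lemma adjacency_diag: "adjacency G v v = 0"
  using adj_not_same by (auto simp: adjacency_def)

lemma sum_adjacency: "(\<Sum>v\<in>verts G. adjacency G u v * f v) = (\<Sum>v | u \<rightarrow>\<^bsub>G\<^esub> v. f v)"
proof -
  have "{v. u \<rightarrow>\<^bsub>G\<^esub> v} \<subseteq> verts G" using adj_in_verts by auto
  then have "(\<Sum>v | u \<rightarrow>\<^bsub>G\<^esub> v. f v) = (\<Sum>v | u \<rightarrow>\<^bsub>G\<^esub> v. adjacency G u v * f v)"
    by (intro sum.cong) (auto simp: adjacency_def)
  also have "\<dots> = (\<Sum>v\<in>verts G. adjacency G u v * f v)"
    using \<open>_ \<subseteq> verts G\<close> by (intro sum.mono_neutral_left) (auto simp: adjacency_def)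
  finally show ?thesis by simp
qed

lemma finite_vwalks: "finite {p. vwalk p G \<and> length p = r \<and> hd p = v}"
proof (rule finite_subset)
  show "{p. vwalk p G \<and> length p = r \<and> hd p = v} \<subseteq> {p. set p \<subseteq> verts G \<and> length p = r}"
    by (auto simp: vwalk_def)
  show "finite {p. set p \<subseteq> verts G \<and> length p = r}"
    by (rule finite_lists_length_eq) simp
qed

lemma num_walks_Suc:
  assumes "v \<in> verts G"
  shows "num_walks G (Suc (Suc m)) v = (\<Sum>u | v \<rightarrow>\<^bsub>G\<^esub> u. num_walks G (Suc m) u)"
proof -
  let ?W = "\<lambda>r v. {p. vwalk p G \<and> length p = r \<and> hd p = v}"
  have "?W (Suc (Suc m)) v = (#) v ` (\<Union>u\<in>{u. v \<rightarrow>\<^bsub>G\<^esub> u}. ?W (Suc m) u)"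
  proof (intro equalityI subsetI)
    fix p assume p: "p \<in> ?W (Suc (Suc m)) v"
    then obtain q where q: "p = v # q" "length q = Suc m" by (cases p) auto
    with p have "q \<in> (\<Union>u\<in>{u. v \<rightarrow>\<^bsub>G\<^esub> u}. ?W (Suc m) u)"
      by (auto simp: vwalk_Cons_iff)
    then show "p \<in> (#) v ` (\<Union>u\<in>{u. v \<rightarrow>\<^bsub>G\<^esub> u}. ?W (Suc m) u)" using q by blast
  qed (use assms in \<open>auto simp: vwalk_Cons_iff\<close>)
  then have "num_walks G (Suc (Suc m)) v = card (\<Union>u\<in>{u. v \<rightarrow>\<^bsub>G\<^esub> u}. ?W (Suc m) u)"
    unfolding num_walks_def by (simp add: card_image)
  also have "\<dots> = (\<Sum>u | v \<rightarrow>\<^bsub>G\<^esub> u. card (?W (Suc m) u))"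
  proof (rule card_UN_disjoint)
    show "finite {u. v \<rightarrow>\<^bsub>G\<^esub> u}"
      by (rule finite_subset[OF _ finite_verts]) (auto dest: adj_in_verts)
  qed (auto intro: finite_vwalks)
  finally show ?thesis by (simp add: num_walks_def)
qed

text \<open>The walk count of the statement is indexed by vertices, the matrix iteration by steps; this is where
  the two are off by one.\<close>
lemma num_walks_eq_walk_weight:
  assumes "v \<in> verts G"
  shows "real (num_walks G (Suc m) v) = walk_weight (verts G) (adjacency G) m v"
  using assms
proof (induction m arbitrary: v)
  case 0
  then have "{p. vwalk p G \<and> length p = 1 \<and> hd p = v} = {[v]}"
    by (auto simp: length_Suc_conv vwalk_Cons_iff)
  then show ?case by (simp add: num_walks_def)
next
  case (Suc m)
  have "walk_weight (verts G) (adjacency G) (Suc m) v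
      = (\<Sum>u\<in>verts G. adjacency G v u * real (num_walks G (Suc m) u))"
    by (simp add: Suc.IH)
  also have "\<dots> = real (num_walks G (Suc (Suc m)) v)"
    by (simp add: sum_adjacency num_walks_Suc[OF Suc.prems])
  finally show ?case by simp
qed

lemma vertex_list_props:
  shows "distinct (vertex_list G)" "set (vertex_list G) = verts G"
proof -
  have "\<exists>vs. distinct vs \<and> set vs = verts G"
    using finite_distinct_list[of "verts G"] by auto
  then have "distinct (vertex_list G) \<and> set (vertex_list G) = verts G"
    unfolding vertex_list_def by (rule someI_ex)
  then show "distinct (vertex_list G)" "set (vertex_list G) = verts G" by auto
qed

lemma bij_betw_vertex_list: "bij_betw ((!) (vertex_list G)) {..<card (verts G)} (verts G)"
  using bij_betw_nth[OF vertex_list_props(1) _ vertex_list_props(2)[symmetric]]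
    distinct_card[OF vertex_list_props(1)] vertex_list_props(2) by simp

text \<open>Transfers eigenvectors indexed by positions in the vertex list to functions on the vertices.\<close>
lemma eigenvalue_adjacency_matrix_iff:
  "eigenvalue (adjacency_matrix G) k \<longleftrightarrow>
     (\<exists>y. (\<exists>v\<in>verts G. y v \<noteq> 0) \<and> (\<forall>v\<in>verts G. (\<Sum>u\<in>verts G. adjacency G v u * y u) = k * y v))"
    (is "?L \<longleftrightarrow> ?R")
proof -
  define n where "n = card (verts G)"
  define e where "e = (!) (vertex_list G)"
  have e: "bij_betw e {..<n} (verts G)" unfolding e_def n_def by (rule bij_betw_vertex_list)
  then have e_verts: "e i \<in> verts G" if "i < n" for i
    using that by (auto simp: bij_betw_def)
  have A: "adjacency_matrix G = mat n n (\<lambda>(i, j). adjacency G (e i) (e j))"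
    unfolding adjacency_matrix_def n_def e_def adjacency_def by (intro cong_mat) auto
  have mult: "(mat n n (\<lambda>(i, j). adjacency G (e i) (e j)) *\<^sub>v vec n (\<lambda>i. y (e i))) $ i
      = (\<Sum>u\<in>verts G. adjacency G (e i) u * y u)" if "i < n" for y i
  proof -
    have "(\<Sum>u\<in>verts G. adjacency G (e i) u * y u) = (\<Sum>j<n. adjacency G (e i) (e j) * y (e j))"
      using sum.reindex_bij_betw[OF e, of "\<lambda>u. adjacency G (e i) u * y u"] by simp
    then show ?thesis using that by (simp add: scalar_prod_def atLeast0LessThan)
  qed
  have char: "eigenvector (adjacency_matrix G) (vec n (\<lambda>i. y (e i))) k \<longleftrightarrow>
     (\<exists>v\<in>verts G. y v \<noteq> 0) \<and> (\<forall>v\<in>verts G. (\<Sum>u\<in>verts G. adjacency G v u * y u) = k * y v)" for y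
  proof -
    have all: "(\<forall>v\<in>verts G. P v) \<longleftrightarrow> (\<forall>i<n. P (e i))" for P
      unfolding bij_betw_imp_surj_on[OF e, symmetric] by auto
    have "vec n (\<lambda>i. y (e i)) = 0\<^sub>v n \<longleftrightarrow> (\<forall>i<n. y (e i) = 0)"
      by (auto simp: vec_eq_iff)
    moreover have "mat n n (\<lambda>(i, j). adjacency G (e i) (e j)) *\<^sub>v vec n (\<lambda>i. y (e i)) = k \<cdot>\<^sub>v vec n (\<lambda>i. y (e i))
        \<longleftrightarrow> (\<forall>i<n. (\<Sum>u\<in>verts G. adjacency G (e i) u * y u) = k * y (e i))"
      using mult by (auto simp: vec_eq_iff simp del: index_mult_mat_vec)
    ultimately show ?thesis
      using all[of "\<lambda>v. y v = 0"] all[of "\<lambda>v. (\<Sum>u\<in>verts G. adjacency G v u * y u) = k * y v"]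
      by (simp add: eigenvector_def A) blast
  qed
  show ?thesis
  proof
    assume ?L
    then obtain v where v: "eigenvector (adjacency_matrix G) v k" by (auto simp: eigenvalue_def)
    have dim: "v \<in> carrier_vec n" using v by (simp add: eigenvector_def A)
    have "v = vec n (\<lambda>i. v $ (inv_into {..<n} e (e i)))"
      using dim e by (intro eq_vecI) (auto simp: bij_betw_def)
    then show ?R using v char[of "\<lambda>u. v $ (inv_into {..<n} e u)"] by auto
  next
    assume ?R
    then show ?L using char by (auto simp: eigenvalue_def)
  qed
qed

lemma largest_eigenvalue_perron:
  assumes "verts G \<noteq> {}"
  obtains x where
    "\<forall>v\<in>verts G. 0 \<le> x v" "(\<Sum>v\<in>verts G. (x v)\<^sup>2) = 1"
    "\<forall>v\<in>verts G. (\<Sum>u\<in>verts G. adjacency G v u * x u) = largest_eigenvalue G * x v"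
    "\<forall>y. quad_form (verts G) (adjacency G) y \<le> largest_eigenvalue G * (\<Sum>v\<in>verts G. (y v)\<^sup>2)"
proof -
  obtain \<mu> x where x: "\<forall>v\<in>verts G. 0 \<le> x v" "(\<Sum>v\<in>verts G. (x v)\<^sup>2) = 1"
    "\<forall>v\<in>verts G. (\<Sum>u\<in>verts G. adjacency G v u * x u) = \<mu> * x v"
    and le: "\<forall>y. quad_form (verts G) (adjacency G) y \<le> \<mu> * (\<Sum>v\<in>verts G. (y v)\<^sup>2)"
    by (rule perron_vector_exists[OF finite_verts assms adjacency_sym adjacency_nonneg])
  have "\<exists>v\<in>verts G. x v \<noteq> 0"
  proof (rule ccontr)
    assume "\<not> ?thesis"
    then have "(\<Sum>v\<in>verts G. (x v)\<^sup>2) = 0" by simp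
    then show False using x(2) by simp
  qed
  then have "eigenvalue (adjacency_matrix G) \<mu>"
    unfolding eigenvalue_adjacency_matrix_iff using x(3) by blast
  moreover have "k \<le> \<mu>" if k: "eigenvalue (adjacency_matrix G) k" for k
  proof -
    obtain y v where y: "v \<in> verts G" "y v \<noteq> 0"
      "\<forall>v\<in>verts G. (\<Sum>u\<in>verts G. adjacency G v u * y u) = k * y v"
      using k unfolding eigenvalue_adjacency_matrix_iff by blast
    have "quad_form (verts G) (adjacency G) y = (\<Sum>v\<in>verts G. y v * (\<Sum>u\<in>verts G. adjacency G v u * y u))"
      unfolding quad_form_def sum_distrib_left by (intro sum.cong refl) simp
    also have "\<dots> = (\<Sum>v\<in>verts G. k * (y v)\<^sup>2)"
      by (intro sum.cong refl) (simp add: y(3) power2_eq_square)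
    also have "\<dots> = k * (\<Sum>v\<in>verts G. (y v)\<^sup>2)"
      by (rule sum_distrib_left[symmetric])
    finally have "k * (\<Sum>v\<in>verts G. (y v)\<^sup>2) \<le> \<mu> * (\<Sum>v\<in>verts G. (y v)\<^sup>2)"
      using spec[OF le, of y] by simp
    moreover have "0 < (\<Sum>v\<in>verts G. (y v)\<^sup>2)"
      using y(1,2) by (intro sum_pos2[of _ v]) auto
    ultimately show ?thesis by simp
  qed
  moreover have "finite (spectrum (adjacency_matrix G))"
    by (rule card_finite_spectrum(1)[of _ "card (verts G)"]) (simp add: adjacency_matrix_def)
  ultimately have "largest_eigenvalue G = \<mu>"
    unfolding largest_eigenvalue_def by (intro Max_eqI) (auto simp: spectrum_def)
  then show ?thesis using that x le by blast
qed

lemma largest_eigenvalue_edgeless: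
  assumes "verts G \<noteq> {}" "edgeless G"
  shows "largest_eigenvalue G = 0"
proof -
  obtain x where "\<forall>v\<in>verts G. 0 \<le> x v" and x: "(\<Sum>v\<in>verts G. (x v)\<^sup>2) = 1"
    "\<forall>v\<in>verts G. (\<Sum>u\<in>verts G. adjacency G v u * x u) = largest_eigenvalue G * x v"
    and "\<forall>y. quad_form (verts G) (adjacency G) y \<le> largest_eigenvalue G * (\<Sum>v\<in>verts G. (y v)\<^sup>2)"
    by (rule largest_eigenvalue_perron[OF assms(1)])
  have "adjacency G u v = 0" for u v
    using assms(2) by (simp add: adjacency_def edgeless_def arcs_ends_def)
  have "largest_eigenvalue G * x v = 0" if "v \<in> verts G" for v
    using bspec[OF x(2) that] \<open>\<And>u v. adjacency G u v = 0\<close> by simp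
  then have "largest_eigenvalue G = 0 \<or> (\<forall>v\<in>verts G. x v = 0)" by auto
  then show ?thesis using x(1) by auto
qed

lemma largest_eigenvalue_pos:
  assumes "\<not> edgeless G"
  shows "0 < largest_eigenvalue G"
proof -
  obtain u v where uv: "u \<rightarrow>\<^bsub>G\<^esub> v"
    using assms by (fastforce simp: edgeless_def arcs_ends_conv)
  then have V: "u \<in> verts G" "v \<in> verts G" by (auto dest: adj_in_verts)
  then have ne: "verts G \<noteq> {}" by auto
  have "0 < (\<Sum>v\<in>verts G. adjacency G u v)"
    using uv V by (intro sum_pos2[of _ v]) (auto simp: adjacency_def)
  also have "\<dots> \<le> (\<Sum>u\<in>verts G. \<Sum>v\<in>verts G. adjacency G u v)"
    using V by (intro member_le_sum[of u "verts G" "\<lambda>u. \<Sum>v\<in>verts G. adjacency G u v"])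
      (auto intro: sum_nonneg adjacency_nonneg)
  also have "\<dots> = quad_form (verts G) (adjacency G) (\<lambda>_. 1)" by (simp add: quad_form_def)
  also have "\<dots> \<le> largest_eigenvalue G * real (card (verts G))"
  proof -
    obtain x where "\<forall>v\<in>verts G. 0 \<le> x v" "(\<Sum>v\<in>verts G. (x v)\<^sup>2) = 1"
      "\<forall>v\<in>verts G. (\<Sum>u\<in>verts G. adjacency G v u * x u) = largest_eigenvalue G * x v"
      and le: "\<forall>y. quad_form (verts G) (adjacency G) y \<le> largest_eigenvalue G * (\<Sum>v\<in>verts G. (y v)\<^sup>2)"
      by (rule largest_eigenvalue_perron[OF ne])
    show ?thesis using spec[OF le, of "\<lambda>_. 1"] by simp
  qed
  finally show ?thesis by (simp add: zero_less_mult_iff)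
qed

end

section \<open>The localized Motzkin--Straus inequality\<close>

definition clique_weight :: "('a, 'b) pre_digraph \<Rightarrow> 'a \<Rightarrow> real" where
  "clique_weight G v = (real (local_clique_number G v) - 1) / real (local_clique_number G v)"

text \<open>Outside the vertex set, where the local clique number has no meaning, this is still nonnegative:
  a value 0 gives 0 by division by zero.\<close>
lemma clique_weight_nonneg: "0 \<le> clique_weight G v"
  by (cases "local_clique_number G v") (auto simp: clique_weight_def)

context graph
begin

lemma graph_induce_subgraph:
  assumes "S \<subseteq> verts G"
  shows "graph (G \<restriction> S)"
proof unfold_locales
  show "finite (verts (G \<restriction> S))" using assms by (simp add: finite_subset[OF _ finite_verts])
  show "symmetric (G \<restriction> S)"
    using sym_arcs assms by (auto simp: symmetric_def arcs_ends_induce_subgraph sym_def)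
qed (use no_loops no_multi_arcs in auto)

lemma is_clique_iff:
  "is_clique G C \<longleftrightarrow> C \<subseteq> verts G \<and> (\<forall>u\<in>C. \<forall>v\<in>C. u \<noteq> v \<longrightarrow> u \<rightarrow>\<^bsub>G\<^esub> v)"
proof -
  have "arcs_ends G \<inter> C \<times> C = {(u, v). (u, v) \<in> C \<times> C \<and> u \<noteq> v}
      \<longleftrightarrow> (\<forall>u\<in>C. \<forall>v\<in>C. u \<noteq> v \<longrightarrow> u \<rightarrow>\<^bsub>G\<^esub> v)"
    using adj_not_same by (auto simp: set_eq_iff)
  then show ?thesis
    using graph_induce_subgraph[of C]
    by (auto simp: is_clique_def complete_digraph_def arcs_ends_induce_subgraph)
qed

lemma finite_clique_sizes: "finite {card C | C. is_clique G C \<and> P C}"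
proof (rule finite_subset)
  show "{card C | C. is_clique G C \<and> P C} \<subseteq> card ` Pow (verts G)"
    by (auto simp: is_clique_def)
qed auto

lemma card_clique_le_local:
  "is_clique G C \<Longrightarrow> v \<in> C \<Longrightarrow> card C \<le> local_clique_number G v"
  unfolding local_clique_number_def
  using finite_clique_sizes[of "\<lambda>C. v \<in> C"] by (intro Max_ge) auto

lemma card_clique_le: "is_clique G C \<Longrightarrow> card C \<le> clique_number G"
  unfolding clique_number_def
  using finite_clique_sizes[of "\<lambda>_. True"] by (intro Max_ge) auto

lemma local_clique_exists:
  assumes "v \<in> verts G"
  obtains C where "is_clique G C" "v \<in> C" "card C = local_clique_number G v"
proof -
  have "is_clique G {v}" using assms by (simp add: is_clique_iff)
  then have "{card C | C. is_clique G C \<and> v \<in> C} \<noteq> {}" by auto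
  then have "local_clique_number G v \<in> {card C | C. is_clique G C \<and> v \<in> C}"
    unfolding local_clique_number_def
    using finite_clique_sizes[of "\<lambda>C. v \<in> C"] by (intro Max_in) auto
  then show ?thesis using that by auto
qed

lemma clique_exists:
  obtains C where "is_clique G C" "card C = clique_number G"
proof -
  have "is_clique G {}" by (simp add: is_clique_iff)
  then have "{card C | C. is_clique G C} \<noteq> {}" by auto
  then have "clique_number G \<in> {card C | C. is_clique G C}"
    unfolding clique_number_def
    using finite_clique_sizes[of "\<lambda>_. True"] by (intro Max_in) auto
  then show ?thesis using that by auto
qed

lemma local_clique_number_adjacent:
  assumes "u \<rightarrow>\<^bsub>G\<^esub> v"
  shows "2 \<le> local_clique_number G u"
proof -
  have "u \<noteq> v" using assms adj_not_same by auto
  moreover have "is_clique G {u, v}"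
    using assms adjacent_sym adj_in_verts by (auto simp: is_clique_iff)
  ultimately show ?thesis using card_clique_le_local[of "{u, v}" u] by simp
qed

lemma local_clique_number_isolated:
  assumes "v \<in> verts G" "\<forall>u. \<not> v \<rightarrow>\<^bsub>G\<^esub> u"
  shows "local_clique_number G v = 1"
proof -
  obtain C where C: "is_clique G C" "v \<in> C" "card C = local_clique_number G v"
    using local_clique_exists[OF assms(1)] .
  have "C = {v}" using C(1,2) assms(2) by (auto simp: is_clique_iff)
  then show ?thesis using C(3) by simp
qed

lemma clique_weight_pos_iff:
  assumes "v \<in> verts G"
  shows "0 < clique_weight G v \<longleftrightarrow> (\<exists>u. v \<rightarrow>\<^bsub>G\<^esub> u)"
proof
  assume "0 < clique_weight G v"
  then show "\<exists>u. v \<rightarrow>\<^bsub>G\<^esub> u"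
    using local_clique_number_isolated[OF assms] by (cases "\<exists>u. v \<rightarrow>\<^bsub>G\<^esub> u") (simp_all add: clique_weight_def)
next
  assume "\<exists>u. v \<rightarrow>\<^bsub>G\<^esub> u"
  then have "2 \<le> local_clique_number G v" using local_clique_number_adjacent by auto
  then show "0 < clique_weight G v" by (simp add: clique_weight_def)
qed

text \<open>Symmetrization reduces this to a clique \<open>K\<close>. Each of its vertices lies in a clique of
  order at least \<open>card K\<close>, so each weight is at least \<open>(card K - 1) / card K\<close> and every scaled entry is
  at most the reciprocal of that.\<close>
theorem local_motzkin_straus:
  assumes "\<forall>v\<in>verts G. 0 \<le> z v"
  shows "quad_form (verts G)
      (\<lambda>u v. adjacency G u v / (sqrt (clique_weight G u) * sqrt (clique_weight G v))) z
      \<le> (\<Sum>v\<in>verts G. z v)\<^sup>2"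
proof -
  let ?b = "\<lambda>u v. adjacency G u v / (sqrt (clique_weight G u) * sqrt (clique_weight G v))"
  show ?thesis
  proof (rule quad_form_le_square_if_cliques[OF finite_verts _ _ _ assms])
    show "?b i j = ?b j i" for i j by (simp add: adjacency_sym[of i j])
    show "?b i i = 0" for i by (simp add: adjacency_diag)
  next
    fix K :: "'a set" and z :: "'a \<Rightarrow> real"
    assume K: "K \<subseteq> verts G" and adj: "\<forall>i\<in>K. \<forall>j\<in>K. i \<noteq> j \<longrightarrow> ?b i j \<noteq> 0" and z: "\<forall>i\<in>K. 0 \<le> z i"
    have clique: "is_clique G K"
      using K adj by (auto simp: is_clique_iff adjacency_def)
    have fin: "finite K" using K by (rule finite_subset) simp
    show "quad_form K ?b z \<le> (\<Sum>i\<in>K. z i)\<^sup>2"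
    proof (rule quad_form_le_square_clique[OF fin _ _ z])
      show "?b i i = 0" for i by (simp add: adjacency_diag)
    next
      fix i j assume ij: "i \<in> K" "j \<in> K" "i \<noteq> j"
      define k where "k = real (card K)"
      have "card {i, j} \<le> card K" using ij fin by (intro card_mono) auto
      then have k: "2 \<le> k" using ij by (simp add: k_def)
      have le: "(k - 1) / k \<le> clique_weight G v" if "v \<in> K" for v
      proof -
        have "k \<le> real (local_clique_number G v)"
          using card_clique_le_local[OF clique that] by (simp add: k_def)
        then show ?thesis using k by (simp add: clique_weight_def field_simps)
      qed
      have pos: "0 < (k - 1) / k" using k by simp
      have "(k - 1) / k = sqrt ((k - 1) / k) * sqrt ((k - 1) / k)" using pos k by simp
      also have "\<dots> \<le> sqrt (clique_weight G i) * sqrt (clique_weight G j)"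
        using le ij pos by (intro mult_mono real_sqrt_le_mono) (auto simp: clique_weight_nonneg)
      finally have "1 / (sqrt (clique_weight G i) * sqrt (clique_weight G j)) \<le> 1 / ((k - 1) / k)"
        by (intro frac_le pos) auto
      moreover have "adjacency G i j = 1"
        using clique ij by (simp add: is_clique_iff adjacency_def)
      ultimately show "?b i j \<le> real (card K) / (real (card K) - 1)"
        by (simp add: k_def)
    qed
  qed
qed

lemma motzkin_straus_weights_graph:
  assumes "\<not> edgeless G"
  obtains x where
    "motzkin_straus_weights (verts G) (adjacency G) x (largest_eigenvalue G) (clique_weight G)"
proof -
  have ne: "verts G \<noteq> {}" using assms tail_in_verts by (fastforce simp: edgeless_def)
  obtain x where x: "\<forall>v\<in>verts G. 0 \<le> x v" "(\<Sum>v\<in>verts G. (x v)\<^sup>2) = 1"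
    "\<forall>v\<in>verts G. (\<Sum>u\<in>verts G. adjacency G v u * x u) = largest_eigenvalue G * x v"
    and "\<forall>y. quad_form (verts G) (adjacency G) y \<le> largest_eigenvalue G * (\<Sum>v\<in>verts G. (y v)\<^sup>2)"
    by (rule largest_eigenvalue_perron[OF ne])
  have "motzkin_straus_weights (verts G) (adjacency G) x (largest_eigenvalue G) (clique_weight G)"
  proof unfold_locales
    show "0 < clique_weight G i" if "i \<in> verts G" "adjacency G i j \<noteq> 0" for i j
      using that by (auto simp: clique_weight_pos_iff adjacency_def)
  qed (use x adjacency_sym adjacency_nonneg adjacency_diag largest_eigenvalue_pos[OF assms]
      clique_weight_nonneg local_motzkin_straus in auto)
  then show ?thesis by (rule that)
qed

end

section \<open>Nonisolated vertices and their walk counts\<close>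

text \<open>Parts of sizes \<open>n\<close> and \<open>p\<close> carry the constant eigenvector entries \<open>x\<close> and \<open>y\<close>; \<open>T\<close> is the total of
  the eigenvector and \<open>l\<close> the eigenvalue. The function \<open>n / (l + n)^2\<close> takes each value at most
  twice, at \<open>n\<close> and at \<open>l^2 / n\<close>, so unequal sizes satisfy \<open>n * p = l^2\<close>; then the two parts account for the
  whole of \<open>T\<close>.\<close>
lemma two_parts_exhaust_if_unequal_sizes:
  fixes l n p x y T :: real
  assumes pos: "0 < l" "0 < n" "0 < p" "0 < T" and ne: "n \<noteq> p"
    and x: "x * (l + n) = T" and y: "y * (l + p) = T" and eq: "n * x\<^sup>2 = p * y\<^sup>2"
  shows "n * x + p * y = T"
proof -
  have x': "x = T / (l + n)" and y': "y = T / (l + p)" using pos x y by (auto simp: field_simps)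
  have "n * (T\<^sup>2 / (l + n)\<^sup>2) = p * (T\<^sup>2 / (l + p)\<^sup>2)" using eq by (simp add: x' y' power_divide)
  then have "n * (l + p)\<^sup>2 = p * (l + n)\<^sup>2"
    using pos by (simp add: field_simps)
  then have "(n - p) * (l\<^sup>2 - n * p) = 0" by (simp add: power2_eq_square algebra_simps)
  then have np: "n * p = l * l" using ne by (simp add: power2_eq_square)
  have "(n * x + p * y) * ((l + n) * (l + p))
      = n * (x * (l + n)) * (l + p) + p * (y * (l + p)) * (l + n)"
    by (simp add: algebra_simps)
  also have "\<dots> = T * (n * (l + p) + p * (l + n))"
    unfolding x y by (simp add: algebra_simps)
  also have "n * (l + p) + p * (l + n) = (l + n) * (l + p)"
    using np by (simp add: algebra_simps)
  finally show ?thesis using pos by simp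
qed

lemma complete_multipartite_2_iff:
  assumes "graph H"
  shows "complete_multipartite 2 H \<longleftrightarrow> complete_bipartite H"
proof -
  interpret H: graph H by fact
  show ?thesis
  proof
    assume "complete_multipartite 2 H"
    then obtain P where P: "partition_on (verts H) P" "card P = 2"
      and adj: "\<forall>u\<in>verts H. \<forall>v\<in>verts H. u \<rightarrow>\<^bsub>H\<^esub> v \<longleftrightarrow> \<not> (\<exists>X\<in>P. u \<in> X \<and> v \<in> X)"
      by (auto simp: complete_multipartite_def)
    obtain U V where UV: "P = {U, V}" "U \<noteq> V" using P(2) by (auto simp: card_2_iff)
    have disj: "U \<inter> V = {}" using P(1) UV by (auto simp: partition_on_def disjoint_def)
    have un: "verts H = U \<union> V" using P(1) UV by (auto simp: partition_on_def)
    have "U \<noteq> {}" "V \<noteq> {}" using P(1) UV by (auto simp: partition_on_def)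
    moreover have "finite U" "finite V" using un H.finite_verts by (metis finite_Un)+
    ultimately have "card U \<ge> 1" "card V \<ge> 1" by (simp_all add: Suc_le_eq card_gt_0_iff)
    moreover have "arcs_ends H = U \<times> V \<union> V \<times> U"
    proof -
      have "(u, v) \<in> arcs_ends H \<longleftrightarrow> (u, v) \<in> U \<times> V \<union> V \<times> U" for u v
      proof (cases "u \<in> verts H \<and> v \<in> verts H")
        case True
        then show ?thesis using adj disj by (auto simp: UV un)
      next
        case False
        then show ?thesis using H.adj_in_verts un by blast
      qed
      then show ?thesis by auto
    qed
    ultimately show "complete_bipartite H"
      using assms un disj by (auto simp: complete_bipartite_def complete_bipartite_digraph_def)
  next
    assume "complete_bipartite H"
    then obtain U V where UV: "verts H = U \<union> V" "U \<inter> V = {}" "card U \<ge> 1" "card V \<ge> 1"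
      "arcs_ends H = U \<times> V \<union> V \<times> U"
      by (auto simp: complete_bipartite_def complete_bipartite_digraph_def)
    then have ne: "U \<noteq> {}" "V \<noteq> {}" by auto
    then have "U \<noteq> V" using UV(2) by auto
    have "partition_on (verts H) {U, V}"
      using UV ne by (auto simp: partition_on_def disjoint_def)
    moreover have "card {U, V} = 2" using \<open>U \<noteq> V\<close> by simp
    moreover have "\<forall>u\<in>verts H. \<forall>v\<in>verts H. u \<rightarrow>\<^bsub>H\<^esub> v \<longleftrightarrow> \<not> (\<exists>X\<in>{U, V}. u \<in> X \<and> v \<in> X)"
      unfolding UV(5) UV(1) using UV(2) by blast
    ultimately show "complete_multipartite 2 H"
      unfolding complete_multipartite_def by blast
  qed
qed

context graph
begin

lemma out_degree_eq: "out_degree G v = card {u. v \<rightarrow>\<^bsub>G\<^esub> u}"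
proof -
  have "{u. v \<rightarrow>\<^bsub>G\<^esub> u} = head G ` out_arcs G v"
    by (auto simp: arcs_ends_conv)
  moreover have "inj_on (head G) (out_arcs G v)"
    by (rule inj_onI) (auto intro!: no_multi_arcs simp: arc_to_ends_def)
  ultimately show ?thesis by (simp add: out_degree_def card_image)
qed

text \<open>The first argument of \<open>W\<close> is the number of steps, one less than the number of vertices.\<close>
abbreviation "W \<equiv> walk_weight (verts G) (adjacency G)"
abbreviation "nonisolated \<equiv> verts (delete_isolated G)"

lemma W_Suc: "W (Suc m) v = (\<Sum>u | v \<rightarrow>\<^bsub>G\<^esub> u. W m u)"
  by (simp add: sum_adjacency)

lemma nonisolated_iff: "v \<in> nonisolated \<longleftrightarrow> (\<exists>u. v \<rightarrow>\<^bsub>G\<^esub> u)"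
  by (auto simp: delete_isolated_def isolated_def adj_in_verts)

lemma nonisolated_verts: "nonisolated \<subseteq> verts G"
  by (auto simp: delete_isolated_def)

lemma finite_nonisolated: "finite nonisolated"
  by (rule finite_subset[OF nonisolated_verts]) simp

lemma adjacent_nonisolated: "u \<rightarrow>\<^bsub>G\<^esub> v \<Longrightarrow> v \<in> nonisolated"
  using adjacent_sym by (auto simp: nonisolated_iff)

lemma graph_delete_isolated: "graph (delete_isolated G)"
  unfolding delete_isolated_def by (rule graph_induce_subgraph) auto

lemma arcs_ends_delete_isolated: "arcs_ends (delete_isolated G) = arcs_ends G"
proof -
  have "a \<in> nonisolated \<and> b \<in> nonisolated" if "a \<rightarrow>\<^bsub>G\<^esub> b" for a b
    using that adjacent_nonisolated adjacent_sym by blast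
  then show ?thesis
    by (auto simp: delete_isolated_def arcs_ends_induce_subgraph)
qed

lemma edgeless_iff: "edgeless G \<longleftrightarrow> nonisolated = {}"
proof -
  have "edgeless G \<longleftrightarrow> arcs_ends G = {}" by (simp add: edgeless_def arcs_ends_conv)
  then show ?thesis using nonisolated_iff by auto
qed

lemma sum_nonisolated_eq: 
  assumes "\<And>v. v \<in> verts G \<Longrightarrow> v \<notin> nonisolated \<Longrightarrow> f v = 0"
  shows "(\<Sum>v\<in>verts G. f v) = (\<Sum>v\<in>nonisolated. f v)"
  using nonisolated_verts assms by (intro sum.mono_neutral_right) auto

lemma W_1: "W (Suc 0) v = real (card {u. v \<rightarrow>\<^bsub>G\<^esub> u})"
  using W_Suc[of 0] by simp

text \<open>One-step walk counts are degrees.\<close>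
lemma regular_iff: "regular (delete_isolated G) \<longleftrightarrow> (\<forall>u\<in>nonisolated. \<forall>v\<in>nonisolated. W (Suc 0) u = W (Suc 0) v)"
proof -
  interpret D: graph "delete_isolated G" by (rule graph_delete_isolated)
  have "W (Suc 0) v = real (out_degree (delete_isolated G) v)" for v
    unfolding D.out_degree_eq arcs_ends_delete_isolated W_1 ..
  then show ?thesis unfolding regular_def by (simp only: of_nat_eq_iff) metis
qed

lemma W_pos: "v \<in> nonisolated \<Longrightarrow> 0 < W m v"
proof (induction m arbitrary: v)
  case (Suc m)
  obtain u where u: "v \<rightarrow>\<^bsub>G\<^esub> u" using Suc.prems by (auto simp: nonisolated_iff)
  have fin: "finite {u. v \<rightarrow>\<^bsub>G\<^esub> u}"
    by (rule finite_subset[OF _ finite_verts]) (auto dest: adj_in_verts)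
  have "0 < (\<Sum>u | v \<rightarrow>\<^bsub>G\<^esub> u. W m u)"
    using Suc.IH adjacent_nonisolated u fin by (intro sum_pos) auto
  then show ?case by (simp only: W_Suc)
qed simp

lemma W_power_if_regular:
  assumes "\<forall>v\<in>nonisolated. W (Suc 0) v = d"
  shows "v \<in> nonisolated \<Longrightarrow> W m v = d ^ m"
proof (induction m arbitrary: v)
  case (Suc m)
  have "W (Suc m) v = (\<Sum>u | v \<rightarrow>\<^bsub>G\<^esub> u. d ^ m)"
    unfolding W_Suc using Suc.IH adjacent_nonisolated by (intro sum.cong) auto
  also have "\<dots> = W (Suc 0) v * d ^ m" by (simp add: W_1 del: walk_weight.simps)
  finally show ?case using assms Suc.prems by (simp del: walk_weight.simps)
qed simp

text \<open>When the two-step count is a constant \<open>\<kappa>\<close>, two further steps multiply every count by \<open>\<kappa>\<close>.\<close>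
lemma W_double:
  assumes "\<forall>v\<in>nonisolated. W 2 v = \<kappa>"
  shows "v \<in> nonisolated \<Longrightarrow> W (2 * j) v = \<kappa> ^ j"
    and "v \<in> nonisolated \<Longrightarrow> W (Suc (2 * j)) v = \<kappa> ^ j * W (Suc 0) v"
proof -
  have odd: "W (Suc (2 * j)) v = \<kappa> ^ j * W (Suc 0) v"
    if "\<forall>v\<in>nonisolated. W (2 * j) v = \<kappa> ^ j" for j v
  proof -
    have "W (Suc (2 * j)) v = (\<Sum>u | v \<rightarrow>\<^bsub>G\<^esub> u. \<kappa> ^ j)"
      unfolding W_Suc using that adjacent_nonisolated by (intro sum.cong) auto
    then show ?thesis by (simp add: W_1 del: walk_weight.simps)
  qed
  have even: "\<forall>v\<in>nonisolated. W (2 * j) v = \<kappa> ^ j" for j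
  proof (induction j)
    case (Suc j)
    show ?case
    proof
      fix v assume v: "v \<in> nonisolated"
      have "W (2 * Suc j) v = (\<Sum>u | v \<rightarrow>\<^bsub>G\<^esub> u. \<kappa> ^ j * W (Suc 0) u)"
        using W_Suc[of "Suc (2 * j)" v] odd[OF Suc] by (simp del: walk_weight.simps)
      also have "\<dots> = \<kappa> ^ j * W 2 v"
        using W_Suc[of "Suc 0" v] by (simp add: sum_distrib_left numeral_2_eq_2 del: walk_weight.simps)
      finally show "W (2 * Suc j) v = \<kappa> ^ Suc j" using assms v by (simp del: walk_weight.simps)
    qed
  qed simp
  show "v \<in> nonisolated \<Longrightarrow> W (2 * j) v = \<kappa> ^ j" using even by blast
  show "v \<in> nonisolated \<Longrightarrow> W (Suc (2 * j)) v = \<kappa> ^ j * W (Suc 0) v" using odd[OF even] .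
qed

lemma W_2_complete_bipartite:
  assumes "complete_bipartite (delete_isolated G)"
  obtains \<kappa> where "\<forall>v\<in>nonisolated. W 2 v = \<kappa>" 
proof -
  obtain X Y where XY: "nonisolated = X \<union> Y" "X \<inter> Y = {}" "arcs_ends G = X \<times> Y \<union> Y \<times> X"
    using assms by (auto simp: complete_bipartite_def complete_bipartite_digraph_def arcs_ends_delete_isolated)
  have nX: "{u. v \<rightarrow>\<^bsub>G\<^esub> u} = Y" if "v \<in> X" for v using that XY(2) unfolding XY(3) by auto
  have nY: "{u. v \<rightarrow>\<^bsub>G\<^esub> u} = X" if "v \<in> Y" for v using that XY(2) unfolding XY(3) by auto
  have "W 2 v = real (card X) * real (card Y)" if "v \<in> nonisolated" for v
  proof -
    have "W 2 v = (\<Sum>u | v \<rightarrow>\<^bsub>G\<^esub> u. W (Suc 0) u)" using W_Suc[of "Suc 0" v] by (simp add: numeral_2_eq_2)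
    also have "\<dots> = real (card X) * real (card Y)"
      using that nX nY unfolding XY(1) by (auto simp: W_1 simp del: walk_weight.simps)
    finally show ?thesis .
  qed
  then show ?thesis by (intro that) auto
qed


section \<open>Cliques in complete multipartite graphs\<close>

text \<open>Nonadjacency is reflexive and symmetric; if it is transitive, its classes are the parts.\<close>
lemma complete_multipartite_if_trans:
  assumes "\<And>i j k. i \<in> nonisolated \<Longrightarrow> j \<in> nonisolated \<Longrightarrow> k \<in> nonisolated \<Longrightarrow>
      \<not> i \<rightarrow>\<^bsub>G\<^esub> j \<Longrightarrow> \<not> j \<rightarrow>\<^bsub>G\<^esub> k \<Longrightarrow> \<not> i \<rightarrow>\<^bsub>G\<^esub> k"
  obtains k where "complete_multipartite k (delete_isolated G)"
proof -
  define R where "R = {(u, v). u \<in> nonisolated \<and> v \<in> nonisolated \<and> \<not> u \<rightarrow>\<^bsub>G\<^esub> v}"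
  have equiv: "equiv nonisolated R"
  proof (rule equivI)
    show "refl_on nonisolated R"
      using adj_not_same by (auto simp: refl_on_def R_def)
    show "sym R" using adjacent_sym by (auto simp: sym_def R_def)
    show "trans R" using assms unfolding trans_def R_def by blast
  qed (auto simp: R_def)
  have part: "partition_on nonisolated (nonisolated // R)"
    using partition_on_quotient[OF equiv] .
  have "u \<rightarrow>\<^bsub>G\<^esub> v \<longleftrightarrow> \<not> (\<exists>X\<in>nonisolated // R. u \<in> X \<and> v \<in> X)" if "u \<in> nonisolated" "v \<in> nonisolated" for u v
  proof -
    have "(\<exists>X\<in>nonisolated // R. u \<in> X \<and> v \<in> X) \<longleftrightarrow> (u, v) \<in> R"
    proof
      assume "\<exists>X\<in>nonisolated // R. u \<in> X \<and> v \<in> X"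
      then show "(u, v) \<in> R" using in_quotient_imp_in_rel[OF equiv] by blast
    next
      assume "(u, v) \<in> R"
      then have "u \<in> R `` {u}" "v \<in> R `` {u}" using equiv_class_self[OF equiv that(1)] by auto
      then show "\<exists>X\<in>nonisolated // R. u \<in> X \<and> v \<in> X" using quotientI[OF that(1)] by blast
    qed
    then show ?thesis using that by (auto simp: R_def)
  qed
  then have "complete_multipartite (card (nonisolated // R)) (delete_isolated G)"
    unfolding complete_multipartite_def arcs_ends_delete_isolated using part by blast
  then show ?thesis by (rule that)
qed

context
  fixes k :: nat
  assumes multipartite: "complete_multipartite k (delete_isolated G)"
    and not_edgeless: "\<not> edgeless G"
begin

lemma multipartite_parts:
  obtains P where "partition_on nonisolated P" "card P = k" "finite P"
    "\<forall>u\<in>nonisolated. \<forall>v\<in>nonisolated. u \<rightarrow>\<^bsub>G\<^esub> v \<longleftrightarrow> \<not> (\<exists>X\<in>P. u \<in> X \<and> v \<in> X)"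
proof -
  obtain P where P: "partition_on nonisolated P" "card P = k"
    "\<forall>u\<in>nonisolated. \<forall>v\<in>nonisolated. u \<rightarrow>\<^bsub>G\<^esub> v \<longleftrightarrow> \<not> (\<exists>X\<in>P. u \<in> X \<and> v \<in> X)"
    using multipartite unfolding complete_multipartite_def arcs_ends_delete_isolated by blast
  have "finite P" using finite_elements[OF finite_nonisolated P(1)] .
  with P that show ?thesis by blast
qed

lemma nonadjacent_trans:
  assumes "i \<in> nonisolated" "j \<in> nonisolated" "l \<in> nonisolated" "\<not> i \<rightarrow>\<^bsub>G\<^esub> j" "\<not> j \<rightarrow>\<^bsub>G\<^esub> l"
  shows "\<not> i \<rightarrow>\<^bsub>G\<^esub> l"
proof -
  obtain P where P: "partition_on nonisolated P" "card P = k" "finite P"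
    "\<forall>u\<in>nonisolated. \<forall>v\<in>nonisolated. u \<rightarrow>\<^bsub>G\<^esub> v \<longleftrightarrow> \<not> (\<exists>X\<in>P. u \<in> X \<and> v \<in> X)"
    by (rule multipartite_parts)
  have adj: "u \<rightarrow>\<^bsub>G\<^esub> v \<longleftrightarrow> \<not> (\<exists>X\<in>P. u \<in> X \<and> v \<in> X)" if "u \<in> nonisolated" "v \<in> nonisolated" for u v
    using P(4) that by simp
  obtain X where X: "X \<in> P" "i \<in> X" "j \<in> X" using adj[OF assms(1,2)] assms(4) by auto
  obtain Y where Y: "Y \<in> P" "j \<in> Y" "l \<in> Y" using adj[OF assms(2,3)] assms(5) by auto
  have "X = Y" using X Y P(1) by (auto simp: partition_on_def disjoint_def)
  then show ?thesis using adj[OF assms(1,3)] X Y by auto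
qed

lemma card_clique_le_parts:
  assumes "is_clique G C"
  shows "card C \<le> k"
proof -
  obtain P where P: "partition_on nonisolated P" "card P = k" "finite P"
    "\<forall>u\<in>nonisolated. \<forall>v\<in>nonisolated. u \<rightarrow>\<^bsub>G\<^esub> v \<longleftrightarrow> \<not> (\<exists>X\<in>P. u \<in> X \<and> v \<in> X)"
    by (rule multipartite_parts)
  have fin: "finite C" using assms finite_subset[OF _ finite_verts] by (auto simp: is_clique_def)
  have "nonisolated \<noteq> {}" using not_edgeless by (simp add: edgeless_iff)
  then have "P \<noteq> {}" using P(1) by (auto simp: partition_on_def)
  then have k: "1 \<le> k" using P(2,3) by (auto simp: Suc_le_eq card_gt_0_iff)
  show ?thesis
  proof (cases "card C \<le> 1")
    case False
    have "C \<subseteq> nonisolated"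
    proof
      fix v assume v: "v \<in> C"
      have "C \<noteq> {v}" using False by auto
      then obtain u where "u \<in> C" "u \<noteq> v" using v by auto
      then have "v \<rightarrow>\<^bsub>G\<^esub> u" using assms v by (simp add: is_clique_iff)
      then show "v \<in> nonisolated" by (auto simp: nonisolated_iff)
    qed
    then have "\<forall>v\<in>C. \<exists>X. X \<in> P \<and> v \<in> X" using P(1) by (auto simp: partition_on_def)
    then obtain f where f: "\<forall>v\<in>C. f v \<in> P \<and> v \<in> f v" by metis
    have "inj_on f C"
    proof (rule inj_onI, rule ccontr)
      fix u v assume uv: "u \<in> C" "v \<in> C" "f u = f v" "u \<noteq> v"
      then have "u \<rightarrow>\<^bsub>G\<^esub> v" using assms by (simp add: is_clique_iff)
      then have "\<not> (\<exists>X\<in>P. u \<in> X \<and> v \<in> X)" using P(4) uv \<open>C \<subseteq> nonisolated\<close> by blast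
      then show False using f uv by metis
    qed
    moreover have "f ` C \<subseteq> P" using f by auto
    ultimately show ?thesis using card_inj_on_le[of f C P] P(2,3) by simp
  qed (use k in simp)
qed

text \<open>One vertex from each part, with \<open>v\<close> chosen from its own part.\<close>
lemma transversal_clique:
  assumes "v \<in> nonisolated"
  obtains C where "is_clique G C" "v \<in> C" "card C = k"
proof -
  obtain P where P: "partition_on nonisolated P" "card P = k" "finite P"
    "\<forall>u\<in>nonisolated. \<forall>v\<in>nonisolated. u \<rightarrow>\<^bsub>G\<^esub> v \<longleftrightarrow> \<not> (\<exists>X\<in>P. u \<in> X \<and> v \<in> X)"
    by (rule multipartite_parts)
  obtain X0 where X0: "X0 \<in> P" "v \<in> X0" using assms P(1) by (auto simp: partition_on_def)
  have "\<forall>X\<in>P. \<exists>u. u \<in> X \<and> (X = X0 \<longrightarrow> u = v)"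
    using P(1) X0 by (auto simp: partition_on_def) (metis ex_in_conv)
  then obtain g where g: "\<forall>X\<in>P. g X \<in> X \<and> (X = X0 \<longrightarrow> g X = v)" by metis
  have disj: "X = Y" if "X \<in> P" "Y \<in> P" "u \<in> X" "u \<in> Y" for X Y u
    using P(1) that by (auto simp: partition_on_def disjoint_def)
  have sub: "g ` P \<subseteq> nonisolated" using g P(1) by (auto simp: partition_on_def)
  have adj: "g X \<rightarrow>\<^bsub>G\<^esub> g Y" if "X \<in> P" "Y \<in> P" "g X \<noteq> g Y" for X Y
  proof -
    have "\<not> (\<exists>Z\<in>P. g X \<in> Z \<and> g Y \<in> Z)" using disj g that by metis
    then show ?thesis using P(4) sub that by blast
  qed
  have "is_clique G (g ` P)"
    using sub nonisolated_verts adj by (auto simp: is_clique_iff)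
  moreover have "inj_on g P" using g disj by (metis inj_onI)
  then have "card (g ` P) = k" using P(2) by (simp add: card_image)
  moreover have "v \<in> g ` P" using g X0 by force
  ultimately show ?thesis using that by blast
qed

lemma clique_number_eq: "clique_number G = k"
proof (rule antisym)
  obtain C where C: "is_clique G C" "card C = clique_number G" by (rule clique_exists)
  show "clique_number G \<le> k" using card_clique_le_parts[OF C(1)] C(2) by simp
  obtain v where "v \<in> nonisolated" using not_edgeless edgeless_iff by auto
  then obtain C where "is_clique G C" "card C = k" using transversal_clique by blast
  then show "k \<le> clique_number G" using card_clique_le by auto
qed

lemma local_clique_number_eq:
  assumes "v \<in> nonisolated"
  shows "local_clique_number G v = k"
proof (rule antisym)
  obtain C where C: "is_clique G C" "card C = local_clique_number G v"
    using local_clique_exists[of v] assms nonisolated_verts by blast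
  show "local_clique_number G v \<le> k" using card_clique_le_parts[OF C(1)] C(2) by simp
  obtain C where C: "is_clique G C" "v \<in> C" "card C = k" by (rule transversal_clique[OF assms])
  then show "k \<le> local_clique_number G v" using card_clique_le_local by auto
qed

lemma two_le_parts: "2 \<le> k"
proof -
  obtain v where "v \<in> nonisolated" using not_edgeless edgeless_iff by auto
  moreover from this obtain u where "v \<rightarrow>\<^bsub>G\<^esub> u" unfolding nonisolated_iff by auto
  ultimately show ?thesis using local_clique_number_adjacent[of v u] local_clique_number_eq[of v] by simp
qed

text \<open>All local clique numbers coincide, so the localized bound is here the global one.\<close>
lemma clique_weight_eq: "v \<in> nonisolated \<Longrightarrow> clique_weight G v = (real k - 1) / real k"
  by (simp add: clique_weight_def local_clique_number_eq)

text \<open>Sum the constant count over a clique meeting every part: nonadjacency being transitive, each vertex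
  is nonadjacent to at most one member of a clique, so it is adjacent to at least \<open>k - 1\<close> of them.\<close>
lemma parts_mult_walks_ge:
  assumes const: "\<forall>v\<in>nonisolated. W (Suc m) v = \<kappa>"
  shows "(real k - 1) * (\<Sum>v\<in>nonisolated. W m v) \<le> real k * \<kappa>"
proof -
  obtain v where "v \<in> nonisolated" using not_edgeless edgeless_iff by auto
  then obtain C where C: "is_clique G C" "card C = k" using transversal_clique by blast
  have fin: "finite C" using C(2) two_le_parts card.infinite by fastforce
  have Cs: "C \<subseteq> nonisolated"
  proof
    fix v assume v: "v \<in> C"
    have "C \<noteq> {v}" using C(2) two_le_parts by auto
    then obtain u where "u \<in> C" "u \<noteq> v" using v by auto
    then have "v \<rightarrow>\<^bsub>G\<^esub> u" using C(1) v by (simp add: is_clique_iff)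
    then show "v \<in> nonisolated" by (auto simp: nonisolated_iff)
  qed
  have row: "real k - 1 \<le> (\<Sum>i\<in>C. adjacency G i j)" if j: "j \<in> nonisolated" for j
  proof -
    let ?N = "{i \<in> C. \<not> i \<rightarrow>\<^bsub>G\<^esub> j}"
    have "\<forall>i\<in>?N. \<forall>l\<in>?N. i = l"
    proof (intro ballI, rule ccontr)
      fix i l assume il: "i \<in> ?N" "l \<in> ?N" "i \<noteq> l"
      then have "\<not> i \<rightarrow>\<^bsub>G\<^esub> l"
        using nonadjacent_trans[of i j l] adjacent_sym[of j l] Cs j by blast
      then show False using C(1) il by (auto simp: is_clique_iff)
    qed
    then have "card ?N \<le> 1" using fin card_le_Suc0_iff_eq[of ?N] by simp
    moreover have "(\<Sum>i\<in>C. adjacency G i j) = real (card C) - real (card ?N)"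
    proof -
      have "real (card ?N) = (\<Sum>i\<in>C. 1 - adjacency G i j)"
      proof -
        have "real (card ?N) = (\<Sum>i\<in>?N. 1)" by simp
        also have "\<dots> = (\<Sum>i\<in>C. if \<not> i \<rightarrow>\<^bsub>G\<^esub> j then 1 else 0)"
          by (rule sum.inter_filter[OF fin])
        also have "\<dots> = (\<Sum>i\<in>C. 1 - adjacency G i j)"
          by (intro sum.cong refl) (simp add: adjacency_def)
        finally show ?thesis .
      qed
      then show ?thesis by (simp add: sum_subtractf)
    qed
    ultimately show ?thesis using C(2) by simp
  qed
  have "(real k - 1) * (\<Sum>v\<in>nonisolated. W m v) = (\<Sum>v\<in>nonisolated. (real k - 1) * W m v)"
    by (rule sum_distrib_left)
  also have "\<dots> \<le> (\<Sum>v\<in>nonisolated. (\<Sum>i\<in>C. adjacency G i v) * W m v)"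
    using row W_pos by (intro sum_mono mult_right_mono) (auto simp: less_imp_le)
  also have "\<dots> = (\<Sum>i\<in>C. \<Sum>v\<in>nonisolated. adjacency G i v * W m v)"
    unfolding sum_distrib_right by (rule sum.swap)
  also have "\<dots> = (\<Sum>i\<in>C. W (Suc m) i)"
  proof (intro sum.cong refl)
    fix i
    have "W (Suc m) i = (\<Sum>v\<in>verts G. adjacency G i v * W m v)" by simp
    also have "\<dots> = (\<Sum>v\<in>nonisolated. adjacency G i v * W m v)"
      using adjacent_nonisolated by (intro sum_nonisolated_eq) (auto simp: adjacency_def)
    finally show "(\<Sum>v\<in>nonisolated. adjacency G i v * W m v) = W (Suc m) i" by simp
  qed
  also have "\<dots> = real k * \<kappa>"
    using const Cs C(2) by (simp add: subset_iff del: walk_weight.simps)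
  finally show ?thesis .
qed

end


section \<open>The equality case\<close>

text \<open>Equality makes nonadjacency transitive away from the isolated vertices, so that all cliques through
  them extend to the same size. Only then is the weight constant, and the first-order condition turns
  into constancy of the number of walks.\<close>
lemma equality_imp_multipartite:
  assumes ne: "\<not> edgeless G"
    and eq: "largest_eigenvalue G ^ Suc m = (\<Sum>v\<in>verts G. W m v * clique_weight G v)"
  obtains x c where "complete_multipartite (clique_number G) (delete_isolated G)"
    "\<forall>v\<in>nonisolated. W (Suc m) v = largest_eigenvalue G ^ Suc m"
    "\<forall>v\<in>nonisolated. 0 < x v"
    "\<forall>v\<in>nonisolated. (\<Sum>u | v \<rightarrow>\<^bsub>G\<^esub> u. x u) = largest_eigenvalue G * x v"
    "\<forall>v\<in>nonisolated. largest_eigenvalue G ^ Suc m * (x v)\<^sup>2 = W m v * c" "0 < c"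
proof -
  obtain x where
    "motzkin_straus_weights (verts G) (adjacency G) x (largest_eigenvalue G) (clique_weight G)"
    using motzkin_straus_weights_graph[OF ne] by blast
  then interpret M: motzkin_straus_weights "verts G" "adjacency G" x "largest_eigenvalue G" "clique_weight G" m .
  have pos_iff: "0 < clique_weight G v \<longleftrightarrow> v \<in> nonisolated" if "v \<in> verts G" for v
    using clique_weight_pos_iff[OF that] nonisolated_iff by simp
  have sv: "v \<in> verts G" "0 < clique_weight G v" if "v \<in> nonisolated" for v
    using that nonisolated_verts pos_iff[of v] by auto
  have eq': "largest_eigenvalue G ^ Suc m = M.walk_total" using eq by (simp add: M.walk_total_def)
  have wp: "0 < W m v" if "v \<in> verts G" "0 < clique_weight G v" for v
    using W_pos pos_iff that by auto
  obtain k where k: "complete_multipartite k (delete_isolated G)"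
  proof (rule complete_multipartite_if_trans)
    fix i j l assume s: "i \<in> nonisolated" "j \<in> nonisolated" "l \<in> nonisolated"
      and n: "\<not> i \<rightarrow>\<^bsub>G\<^esub> j" "\<not> j \<rightarrow>\<^bsub>G\<^esub> l"
    have "adjacency G i l = 0"
      by (rule M.nonadjacency_trans[OF eq' wp sv(1)[OF s(1)] sv(1)[OF s(2)] sv(1)[OF s(3)]
            sv(2)[OF s(1)] sv(2)[OF s(2)] sv(2)[OF s(3)]])
         (use n in \<open>simp_all add: adjacency_def\<close>)
    then show "\<not> i \<rightarrow>\<^bsub>G\<^esub> l" by (simp add: adjacency_def)
  qed
  define c where "c = (real k - 1) / real k"
  have c: "clique_weight G v = c" if "v \<in> nonisolated" for v
    using clique_weight_eq[OF k ne that] by (simp add: c_def)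
  have c_pos: "0 < c" using two_le_parts[OF k ne] by (simp add: c_def)
  have isolated_col: "adjacency G i j = 0" if "j \<notin> nonisolated" for i j
    using that adjacent_nonisolated by (auto simp: adjacency_def)
  have walks: "W (Suc m) i = largest_eigenvalue G ^ Suc m" if i: "i \<in> nonisolated" for i
  proof -
    have "sqrt c * largest_eigenvalue G ^ Suc m
        = (\<Sum>j\<in>verts G. adjacency G i j * (W m j * sqrt (clique_weight G j)))"
      using M.weighted_walk_sum[OF eq' wp sv[OF i]] c[OF i] eq' by simp
    also have "\<dots> = (\<Sum>j\<in>verts G. sqrt c * (adjacency G i j * W m j))"
    proof (intro sum.cong refl)
      fix j
      show "adjacency G i j * (W m j * sqrt (clique_weight G j)) = sqrt c * (adjacency G i j * W m j)"
        using c[of j] isolated_col[of j i] by (cases "j \<in> nonisolated") simp_all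
    qed
    also have "\<dots> = sqrt c * W (Suc m) i" by (simp add: sum_distrib_left)
    finally show ?thesis using c_pos by simp
  qed
  show ?thesis
  proof (rule that)
    show "complete_multipartite (clique_number G) (delete_isolated G)"
      using k clique_number_eq[OF k ne] by simp
    show "\<forall>v\<in>nonisolated. 0 < x v" using M.x_pos[OF eq' wp] sv by blast
    show "\<forall>v\<in>nonisolated. (\<Sum>u | v \<rightarrow>\<^bsub>G\<^esub> u. x u) = largest_eigenvalue G * x v"
      using M.eigen sv(1) by (simp add: sum_adjacency)
    show "\<forall>v\<in>nonisolated. largest_eigenvalue G ^ Suc m * (x v)\<^sup>2 = W m v * c"
      unfolding eq' using M.square_perron_eq[OF eq' wp] sv(1) c by auto
  qed (use walks c_pos in auto)
qed

text \<open>On a part of size \<open>n\<close> the eigenvector is constant, and so is the number of walks. Constancy of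
  the next walk count says that the walk counts on each part have the same sum; since they are
  proportional to the squared eigenvector entries, \<open>n * x^2\<close> is the same for all parts. By
  \<open>two_parts_exhaust_if_unequal_sizes\<close> two parts of different size would leave nothing of the
  positive eigenvector for a third part.\<close>
lemma regular_if_three_parts:
  assumes multi: "complete_multipartite k (delete_isolated G)" and k: "3 \<le> k"
    and ne: "\<not> edgeless G" and S_pos: "0 < S" and ev_pos: "0 < ev" and c: "0 < c"
    and walks: "\<forall>v\<in>nonisolated. W (Suc m) v = \<kappa>"
    and x_pos: "\<forall>v\<in>nonisolated. 0 < x v"
    and eigen: "\<forall>v\<in>nonisolated. (\<Sum>u | v \<rightarrow>\<^bsub>G\<^esub> u. x u) = ev * x v"
    and square: "\<forall>v\<in>nonisolated. S * (x v)\<^sup>2 = W m v * c"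
  shows "regular (delete_isolated G)"
proof -
  obtain P where P: "partition_on nonisolated P" "card P = k" "finite P"
    "\<forall>u\<in>nonisolated. \<forall>v\<in>nonisolated. u \<rightarrow>\<^bsub>G\<^esub> v \<longleftrightarrow> \<not> (\<exists>X\<in>P. u \<in> X \<and> v \<in> X)"
    by (rule multipartite_parts[OF multi ne])
  have sub: "X \<subseteq> nonisolated" if "X \<in> P" for X using P(1) that by (auto simp: partition_on_def)
  have finX: "finite X" if "X \<in> P" for X using sub[OF that] finite_nonisolated finite_subset by blast
  have disj: "X \<inter> Y = {}" if "X \<in> P" "Y \<in> P" "X \<noteq> Y" for X Y
    using P(1) that by (auto simp: partition_on_def disjoint_def)
  have nbrs: "{u. v \<rightarrow>\<^bsub>G\<^esub> u} = nonisolated - X" if X: "X \<in> P" "v \<in> X" for X v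
  proof (rule Set.set_eqI)
    fix u
    have v: "v \<in> nonisolated" using X sub by auto
    have only: "Y = X" if "Y \<in> P" "v \<in> Y" for Y using disj[of Y X] X that by auto
    show "u \<in> {u. v \<rightarrow>\<^bsub>G\<^esub> u} \<longleftrightarrow> u \<in> nonisolated - X"
    proof (cases "u \<in> nonisolated")
      case True
      then have "v \<rightarrow>\<^bsub>G\<^esub> u \<longleftrightarrow> \<not> (\<exists>X\<in>P. v \<in> X \<and> u \<in> X)" using P(4) v by simp
      also have "(\<exists>X\<in>P. v \<in> X \<and> u \<in> X) \<longleftrightarrow> u \<in> X"
      proof
        assume "\<exists>Y\<in>P. v \<in> Y \<and> u \<in> Y"
        then obtain Y where "Y \<in> P" "v \<in> Y" "u \<in> Y" by auto
        then show "u \<in> X" using only[of Y] by simp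
      qed (use X in auto)
      finally show ?thesis using True by simp
    qed (use adjacent_nonisolated in auto)
  qed
  have nbr_sum: "(\<Sum>u | v \<rightarrow>\<^bsub>G\<^esub> u. f u) = (\<Sum>u\<in>nonisolated. f u) - (\<Sum>u\<in>X. f u)"
    if X: "X \<in> P" "v \<in> X" for X v and f :: "'a \<Rightarrow> real"
    unfolding nbrs[OF X] using sub[OF X(1)] finite_nonisolated by (simp add: sum_diff)
  define T where "T = (\<Sum>u\<in>nonisolated. x u)"
  have x_row: "ev * x v = T - (\<Sum>u\<in>X. x u)" if X: "X \<in> P" "v \<in> X" for X v
    using nbr_sum[OF X, of x] eigen sub[OF X(1)] X(2) by (auto simp: T_def)
  have x_const: "x u = x v" if "X \<in> P" "u \<in> X" "v \<in> X" for X u v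
  proof -
    have "ev * x u = ev * x v" using x_row[of X u] x_row[of X v] that by simp
    then show ?thesis using ev_pos by simp
  qed
  have x_sum: "(\<Sum>u\<in>X. x u) = real (card X) * x v" if X: "X \<in> P" "v \<in> X" for X v
  proof -
    have "(\<Sum>u\<in>X. x u) = (\<Sum>u\<in>X. x v)" using x_const[OF X(1) _ X(2)] by (intro sum.cong) auto
    then show ?thesis by simp
  qed
  have x_eq: "x v * (ev + real (card X)) = T" if X: "X \<in> P" "v \<in> X" for X v
    using x_row[OF X] x_sum[OF X] by (simp add: algebra_simps)
  have W_eq: "real (card X) * (x v)\<^sup>2 = ((\<Sum>u\<in>nonisolated. W m u) - \<kappa>) * c / S"
    if X: "X \<in> P" "v \<in> X" for X v
  proof -
    have sq: "W m u * c = S * (x v)\<^sup>2" if "u \<in> X" for u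
    proof -
      have "u \<in> nonisolated" using sub[OF X(1)] that by auto
      then have "S * (x u)\<^sup>2 = W m u * c" using square by simp
      then show ?thesis by (simp only: x_const[OF X(1) that X(2)])
    qed
    have "((\<Sum>u\<in>nonisolated. W m u) - \<kappa>) * c = (\<Sum>u\<in>X. W m u) * c"
      using nbr_sum[OF X, of "W m"] walks sub[OF X(1)] X(2) W_Suc[of m v]
      by (auto simp del: walk_weight.simps)
    also have "\<dots> = (\<Sum>u\<in>X. S * (x v)\<^sup>2)"
      unfolding sum_distrib_right using sq by (intro sum.cong) auto
    finally show ?thesis using S_pos by simp
  qed
  have card_eq: "card X = card Y" if XY: "X \<in> P" "Y \<in> P" for X Y
  proof (rule ccontr)
    assume ne_card: "card X \<noteq> card Y"
    then have "X \<noteq> Y" by auto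
    have "\<exists>Z\<in>P. Z \<noteq> X \<and> Z \<noteq> Y"
    proof (rule ccontr)
      assume "\<not> ?thesis"
      then have "P \<subseteq> {X, Y}" by auto
      then have "card P \<le> card {X, Y}" by (intro card_mono) auto
      also have "\<dots> \<le> 2" by (simp add: card_insert_if)
      finally show False using P(2) k by simp
    qed
    then obtain Z where Z: "Z \<in> P" "Z \<noteq> X" "Z \<noteq> Y" by auto
    have nonempty: "\<exists>v. v \<in> A" if "A \<in> P" for A
      unfolding ex_in_conv using P(1) that by (auto simp: partition_on_def)
    obtain u where u: "u \<in> X" using nonempty[OF XY(1)] by auto
    obtain v where v: "v \<in> Y" using nonempty[OF XY(2)] by auto
    have sum_pos: "0 < (\<Sum>u\<in>A. x u)" if "A \<in> P" for A
      using that nonempty[OF that] x_pos sub[OF that] finX[OF that] by (intro sum_pos) auto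
    have "(\<Sum>u\<in>X. x u) + (\<Sum>u\<in>Y. x u) + (\<Sum>u\<in>Z. x u) = (\<Sum>u\<in>X \<union> Y \<union> Z. x u)"
    proof -
      have "(\<Sum>u\<in>X \<union> Y. x u) = (\<Sum>u\<in>X. x u) + (\<Sum>u\<in>Y. x u)"
        using finX XY disj[OF XY \<open>X \<noteq> Y\<close>] by (intro sum.union_disjoint) auto
      moreover have "(X \<union> Y) \<inter> Z = {}"
        using disj[OF XY(1) Z(1)] disj[OF XY(2) Z(1)] Z(2,3) by auto
      then have "(\<Sum>u\<in>X \<union> Y \<union> Z. x u) = (\<Sum>u\<in>X \<union> Y. x u) + (\<Sum>u\<in>Z. x u)"
        using finX XY Z(1) by (intro sum.union_disjoint) auto
      ultimately show ?thesis by simp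
    qed
    also have "\<dots> \<le> T"
      unfolding T_def using sub XY Z x_pos finite_nonisolated
      by (intro sum_mono2) (auto simp: less_imp_le)
    finally have T: "(\<Sum>u\<in>X. x u) + (\<Sum>u\<in>Y. x u) < T" "0 < T"
      using sum_pos[OF Z(1)] sum_pos[OF XY(1)] sum_pos[OF XY(2)] by auto
    have "0 < card X" "0 < card Y" using u v finX XY by (auto simp: card_gt_0_iff)
    then have "real (card X) * x u + real (card Y) * x v = T"
      using x_eq[OF XY(1) u] x_eq[OF XY(2) v] W_eq[OF XY(1) u] W_eq[OF XY(2) v] ev_pos T(2) ne_card
      by (intro two_parts_exhaust_if_unequal_sizes[of ev]) auto
    then show False using T(1) x_sum[OF XY(1) u] x_sum[OF XY(2) v] by simp
  qed
  have deg: "W (Suc 0) v = real (card nonisolated) - real (card X)" if X: "X \<in> P" "v \<in> X" for X v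
    using nbr_sum[OF X, of "\<lambda>_. 1"] by (simp add: W_1 del: walk_weight.simps)
  have cover: "\<exists>X\<in>P. v \<in> X" if "v \<in> nonisolated" for v using P(1) that by (auto simp: partition_on_def)
  show ?thesis
    unfolding regular_iff
  proof (intro ballI)
    fix u v assume "u \<in> nonisolated" "v \<in> nonisolated"
    then obtain X Y where "X \<in> P" "u \<in> X" "Y \<in> P" "v \<in> Y" using cover by blast
    then show "W (Suc 0) u = W (Suc 0) v" using deg card_eq by metis
  qed
qed

lemma power_le_weighted_walks:
  assumes "verts G \<noteq> {}"
  shows "largest_eigenvalue G ^ Suc m \<le> (\<Sum>v\<in>verts G. W m v * clique_weight G v)"
proof (cases "edgeless G")
  case True
  have "0 \<le> W m v" for v
    by (induction m arbitrary: v) (auto intro!: sum_nonneg mult_nonneg_nonneg adjacency_nonneg)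
  then show ?thesis
    using largest_eigenvalue_edgeless[OF assms True]
    by (auto intro!: sum_nonneg mult_nonneg_nonneg clique_weight_nonneg)
next
  case False
  then obtain x where
    "motzkin_straus_weights (verts G) (adjacency G) x (largest_eigenvalue G) (clique_weight G)"
    using motzkin_straus_weights_graph by blast
  then interpret M: motzkin_straus_weights "verts G" "adjacency G" x "largest_eigenvalue G" "clique_weight G" m .
  show ?thesis using M.power_le_walk_total by (simp only: M.walk_total_def)
qed

text \<open>Pairing the all-one vector with the eigenvector identifies the power of the eigenvalue with the
  constant \<open>\<kappa>\<close>. As one inequality holds for every graph, only the other has to be shown,
  and for it the count over a maximum clique suffices.\<close>
lemma equality_if_multipartite:
  assumes ne: "\<not> edgeless G" and multi: "complete_multipartite k (delete_isolated G)"
    and const: "\<forall>v\<in>nonisolated. W (Suc m) v = \<kappa>"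
  shows "largest_eigenvalue G ^ Suc m = (\<Sum>v\<in>verts G. W m v * clique_weight G v)"
proof (rule antisym)
  have "verts G \<noteq> {}" using ne edgeless_iff nonisolated_verts by auto
  then show "largest_eigenvalue G ^ Suc m \<le> (\<Sum>v\<in>verts G. W m v * clique_weight G v)"
    by (rule power_le_weighted_walks)
  obtain x where
    "motzkin_straus_weights (verts G) (adjacency G) x (largest_eigenvalue G) (clique_weight G)"
    using motzkin_straus_weights_graph[OF ne] by blast
  then interpret M: motzkin_straus_weights "verts G" "adjacency G" x "largest_eigenvalue G" "clique_weight G" m .
  have x0: "x v = 0" if v: "v \<in> verts G" "v \<notin> nonisolated" for v
  proof -
    have "adjacency G v u = 0" for u using v by (auto simp: adjacency_def nonisolated_iff)
    then show ?thesis using M.eigen[OF v(1)] M.\<mu>_pos by simp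
  qed
  have "0 < (\<Sum>v\<in>verts G. x v)"
  proof -
    have "(\<Sum>v\<in>verts G. x v) \<noteq> 0"
    proof
      assume "(\<Sum>v\<in>verts G. x v) = 0"
      then have "\<forall>v\<in>verts G. x v = 0" using M.x_nonneg by (simp add: sum_nonneg_eq_0_iff)
      then show False using M.x_unit by simp
    qed
    then show ?thesis using M.x_nonneg by (simp add: sum_nonneg less_le)
  qed
  moreover have "(\<Sum>v\<in>verts G. W (Suc m) v * x v) = (\<Sum>v\<in>verts G. \<kappa> * x v)"
    using const x0 by (intro sum.cong refl) (metis mult_zero_right)
  then have "largest_eigenvalue G ^ Suc m * (\<Sum>v\<in>verts G. x v) = \<kappa> * (\<Sum>v\<in>verts G. x v)"
    using M.sum_walk_weight_mult_perron[of "Suc m"] by (simp add: sum_distrib_left)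
  ultimately have \<kappa>: "largest_eigenvalue G ^ Suc m = \<kappa>" by simp
  have k: "2 \<le> k" by (rule two_le_parts[OF multi ne])
  have "(\<Sum>v\<in>verts G. W m v * clique_weight G v) = (\<Sum>v\<in>nonisolated. W m v * clique_weight G v)"
  proof (rule sum_nonisolated_eq)
    fix v assume "v \<in> verts G" "v \<notin> nonisolated"
    then have "\<not> 0 < clique_weight G v" using clique_weight_pos_iff nonisolated_iff by simp
    then show "W m v * clique_weight G v = 0" using clique_weight_nonneg[of G v] by simp
  qed
  also have "\<dots> = (real k - 1) * (\<Sum>v\<in>nonisolated. W m v) / real k"
    unfolding sum_distrib_left sum_divide_distrib
    by (intro sum.cong refl) (simp add: clique_weight_eq[OF multi ne])
  also have "\<dots> \<le> \<kappa>"
    using parts_mult_walks_ge[OF multi ne const] k by (simp add: field_simps)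
  finally show "(\<Sum>v\<in>verts G. W m v * clique_weight G v) \<le> largest_eigenvalue G ^ Suc m"
    using \<kappa> by simp
qed

text \<open>The two-step count of a complete bipartite graph is the product of the sizes of its sides. Hence the
  counts for an even number of steps are constant, and those for an odd number are a constant multiple
  of the degree.\<close>
lemma walks_const_iff_complete_bipartite:
  assumes ne: "\<not> edgeless G" and bip: "complete_bipartite (delete_isolated G)"
  shows "(\<exists>\<kappa>. \<forall>v\<in>nonisolated. W m v = \<kappa>) \<longleftrightarrow> (odd m \<longrightarrow> regular (delete_isolated G))"
proof -
  obtain \<kappa> where \<kappa>: "\<forall>v\<in>nonisolated. W 2 v = \<kappa>" using W_2_complete_bipartite[OF bip] .
  obtain v0 where "v0 \<in> nonisolated" using ne edgeless_iff by auto
  then have \<kappa>_pos: "0 < \<kappa>" using \<kappa> W_pos[of v0 2] by (simp del: walk_weight.simps)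
  show ?thesis
  proof (cases "even m")
    case True
    then obtain j where "m = 2 * j" by auto
    then show ?thesis using W_double(1)[OF \<kappa>] by auto
  next
    case False
    then obtain j where "m = Suc (2 * j)" by (auto elim: oddE)
    then have W: "W m v = \<kappa> ^ j * W (Suc 0) v" if "v \<in> nonisolated" for v
      using W_double(2)[OF \<kappa> that] by simp
    have "(\<exists>\<kappa>. \<forall>v\<in>nonisolated. W m v = \<kappa>) \<longleftrightarrow> (\<forall>u\<in>nonisolated. \<forall>v\<in>nonisolated. W m u = W m v)"
      by metis
    also have "\<dots> \<longleftrightarrow> regular (delete_isolated G)"
      unfolding regular_iff using W \<kappa>_pos by (auto simp del: walk_weight.simps)
    finally show ?thesis using False by simp
  qed
qed

theorem equality_iff:
  assumes ne: "\<not> edgeless G"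
  shows "largest_eigenvalue G ^ Suc m = (\<Sum>v\<in>verts G. W m v * clique_weight G v) \<longleftrightarrow>
    ((Suc m = 1 \<or> clique_number G \<ge> 3) \<and> regular (delete_isolated G) \<and>
       complete_multipartite (clique_number G) (delete_isolated G)) \<or>
    (Suc m \<ge> 2 \<and> clique_number G = 2 \<and> complete_bipartite (delete_isolated G) \<and>
       (odd (Suc m) \<longrightarrow> regular (delete_isolated G)))" (is "?eq \<longleftrightarrow> ?A \<or> ?B")
proof
  assume eq: ?eq
  obtain x c where multi: "complete_multipartite (clique_number G) (delete_isolated G)"
    and walks: "\<forall>v\<in>nonisolated. W (Suc m) v = largest_eigenvalue G ^ Suc m"
    and x: "\<forall>v\<in>nonisolated. 0 < x v"
      "\<forall>v\<in>nonisolated. (\<Sum>u | v \<rightarrow>\<^bsub>G\<^esub> u. x u) = largest_eigenvalue G * x v"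
      "\<forall>v\<in>nonisolated. largest_eigenvalue G ^ Suc m * (x v)\<^sup>2 = W m v * c" "0 < c"
    by (rule equality_imp_multipartite[OF ne eq])
  have pos: "0 < largest_eigenvalue G" by (rule largest_eigenvalue_pos[OF ne])
  consider "m = 0" | "3 \<le> clique_number G" | "m \<noteq> 0" "clique_number G = 2"
    using two_le_parts[OF multi ne] by linarith
  then show "?A \<or> ?B"
  proof cases
    case 1
    then have "regular (delete_isolated G)" unfolding regular_iff using walks by simp
    then show ?thesis using 1 multi by simp
  next
    case 2
    have "regular (delete_isolated G)"
      using regular_if_three_parts[OF multi 2 ne _ pos x(4) walks x(1-3)] pos
      by (simp del: walk_weight.simps)
    then show ?thesis using 2 multi by simp
  next
    case 3
    then have bip: "complete_bipartite (delete_isolated G)"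
      using multi complete_multipartite_2_iff[OF graph_delete_isolated] by simp
    then have "odd (Suc m) \<longrightarrow> regular (delete_isolated G)"
      using walks_const_iff_complete_bipartite[OF ne bip, of "Suc m"] walks by blast
    then show ?thesis using bip 3 by simp
  qed
next
  assume "?A \<or> ?B"
  then show ?eq
  proof
    assume A: ?A
    obtain v where "v \<in> nonisolated" using ne edgeless_iff by auto
    then have "\<forall>u\<in>nonisolated. W (Suc 0) u = W (Suc 0) v" using A regular_iff by blast
    from W_power_if_regular[OF this, of _ "Suc m"]
    have const: "\<forall>u\<in>nonisolated. W (Suc m) u = W (Suc 0) v ^ Suc m" by blast
    have "complete_multipartite (clique_number G) (delete_isolated G)" using A by blast
    then show ?eq using const by (rule equality_if_multipartite[OF ne])
  next
    assume B: ?B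
    then have multi: "complete_multipartite 2 (delete_isolated G)"
      using complete_multipartite_2_iff[OF graph_delete_isolated] by simp
    obtain \<kappa> where "\<forall>v\<in>nonisolated. W (Suc m) v = \<kappa>"
      using walks_const_iff_complete_bipartite[OF ne, of "Suc m"] B by blast
    then show ?eq by (rule equality_if_multipartite[OF ne multi])
  qed
qed

end

theorem corollary1p4:
  fixes G :: "('a, 'b) pre_digraph" and r :: nat
  assumes "graph G" and "verts G \<noteq> {}" and "r \<ge> 1"
  shows "largest_eigenvalue G ^ r
           \<le> (\<Sum>v\<in>verts G. real (num_walks G r v) *
                ((real (local_clique_number G v) - 1) / real (local_clique_number G v)))
       \<and> (largest_eigenvalue G ^ r
           = (\<Sum>v\<in>verts G. real (num_walks G r v) *
                ((real (local_clique_number G v) - 1) / real (local_clique_number G v)))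
         \<longleftrightarrow>
           edgeless G \<or>
           ((r = 1 \<or> clique_number G \<ge> 3) \<and>
              regular (delete_isolated G) \<and>
              complete_multipartite (clique_number G) (delete_isolated G)) \<or>
           (r \<ge> 2 \<and> clique_number G = 2 \<and>
              complete_bipartite (delete_isolated G) \<and>
              (odd r \<longrightarrow> regular (delete_isolated G))))"
proof -
  interpret graph G by fact
  obtain m where r: "r = Suc m" using \<open>r \<ge> 1\<close> by (cases r) auto
  have sum: "(\<Sum>v\<in>verts G. real (num_walks G r v) *
                ((real (local_clique_number G v) - 1) / real (local_clique_number G v)))
      = (\<Sum>v\<in>verts G. W m v * clique_weight G v)"
    unfolding r clique_weight_def by (intro sum.cong refl) (simp only: num_walks_eq_walk_weight)
  have le: "largest_eigenvalue G ^ r \<le> (\<Sum>v\<in>verts G. W m v * clique_weight G v)"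
    unfolding r by (rule power_le_weighted_walks[OF assms(2)])
  have edgeless: "largest_eigenvalue G ^ r = (\<Sum>v\<in>verts G. W m v * clique_weight G v)" if "edgeless G"
  proof -
    have "clique_weight G v = 0" if "v \<in> verts G" for v
      using clique_weight_pos_iff[OF that] clique_weight_nonneg[of G v] \<open>edgeless G\<close> edgeless_iff nonisolated_iff
      by auto
    then show ?thesis using largest_eigenvalue_edgeless[OF assms(2) that] r by simp
  qed
  show ?thesis
    unfolding sum using le edgeless equality_iff[of m, folded r] by blast
qed

end
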